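(* Let $\mathbb{G}=V_1\oplus\cdots\oplus V_\iota$ be a stratified group and let $d$ be a homogeneous distance on $\mathbb{G}$. If $d$ is $V_1$-vertically symmetric, then $\beta(d,\cdot)$ is a constant function on $V_1\setminus\{0\}$.
   Context: **Stratified group.** $\mathbb{G}=V_1\oplus\cdots\oplus V_\iota$ is a graded finite-dimensional real vector space of dimension $n$, with a simply connected nilpotent Lie group structure given by the Baker-Campbell-Hausdorff product (the group is identified with its Lie algebra through the exponential map, with unit $0$). Its Lie algebra of left invariant vector fields is graded, $\mathcal{G}=\mathcal{V}_1\oplus\cdots\oplus\mathcal{V}_\iota$, where $\mathcal{V}_j$ consists of the left invariant fields whose value at $0$ lies in $V_j$. It satisfies $[\mathcal{V}_1,\mathcal{V}_j]=\mathcal{V}_{j+1}$ for all $j\ge1$, with $\mathcal{V}_i=\{0\}$ for $i>\iota$ and $V_\iota\ne\{0\}$. The dilations are $\delta_r(v)=r^jv$ for $v\in V_j$, $r>0$, extended linearly. **Homogeneous distance.** A continuous left invariant distance $d$ on $\mathbb{G}$ with $d(\delta_rx,\delta_ry)=r\,d(x,y)$ for all $x,y\in\mathbb{G}$, $r>0$. Closed balls are $\mathbb{B}(y,r)=\{z:d(z,y)\le r\}$. **Scalar product and $\beta$.** A basis of $\mathbb{G}$ adapted to the grading (consecutive blocks are bases of $V_1,\dots,V_\iota$) is fixed, together with the scalar product making it orthonormal, with norm $|\cdot|$. $\mathcal{H}^{n-1}$ is the $(n-1)$-dimensional Hausdorff measure with respect to the corresponding Euclidean distance, normalized to agree with Lebesgue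 measure on $(n-1)$-dimensional linear subspaces. For $\nu\in V_1\setminus\{0\}$ let $N(\nu)=\nu^\bot\oplus V_2\oplus\cdots\oplus V_\iota$, where $\nu^\bot$ is the orthogonal complement of $\nu$ in $V_1$, and $$\beta(d,\nu)=\max_{z\in\mathbb{B}(0,1)}\mathcal{H}^{n-1}\big(\mathbb{B}(z,1)\cap N(\nu)\big).$$ **$V_1$-vertically symmetric distance.** Let $W=V_2\oplus\cdots\oplus V_\iota$, let $O(V_1)$ be the group of linear isometries of $V_1$, and let ${\bf p}_1:\mathbb{G}\to V_1$ be the orthogonal projection. The homogeneous distance $d$ is $V_1$-vertically symmetric if there is a family $\mathcal{F}_1\subset O(V_1)$ acting transitively on $V_1$ in the sense that for all $\nu_1,\nu_2\in V_1$ with $|\nu_1|=|\nu_2|$ there is $T\in\mathcal{F}_1$ with $T\nu_1=\nu_2$, such that, setting $\mathcal{O}_1=\{T\in GL(\mathbb{G}): T|_W=\mathrm{Id}_W,\ T|_{V_1}\in\mathcal{F}_1\}$ ($GL(\mathbb{G})$ being the invertible linear maps of $\mathbb{G}$ as a vector space): (1) ${\bf p}_1(\mathbb{B}(0,1))=\mathbb{B}(0,1)\cap V_1=\{h\in V_1:|h|\le r_0\}$ for some $r_0>0$; (2) $T(\mathbb{B}(0,1))=\mathbb{B}(0,1)$ for all $T\in\mathcal{O}_1$. *)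

theory Defs
  imports "HOL-Analysis.Analysis"
begin

section \<open>The group product\<close>

text \<open>Right-nested brackets: the word \<open>[x\<^sub>1, \<dots>, x\<^sub>m]\<close> becomes
  \<open>[x\<^sub>1, [x\<^sub>2, \<dots> [x\<^sub>m\<^sub>-\<^sub>1, x\<^sub>m] \<dots>]]\<close>.\<close>

fun nested_bracket :: "('a \<Rightarrow> 'a \<Rightarrow> 'a) \<Rightarrow> 'a list \<Rightarrow> 'a::real_vector" where
  "nested_bracket lie [] = 0"
| "nested_bracket lie [x] = x"
| "nested_bracket lie (x # y # w) = lie x (nested_bracket lie (y # w))"

definition bch_indices :: "nat \<Rightarrow> (nat \<times> nat) list set" where
  "bch_indices m =
    {ps. ps \<noteq> [] \<and> (\<forall>(r, s) \<in> set ps. r + s > 0) \<and> (\<Sum>(r, s)\<leftarrow>ps. r + s) \<le> m}"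

text \<open>Dynkin's form of the Baker--Campbell--Hausdorff series,
  \[ \sum_{k \ge 1} \frac{(-1)^{k-1}}{k} \sum_{r_i + s_i > 0}
     \frac{[x^{r_1} y^{s_1} \cdots x^{r_k} y^{s_k}]}{\sum_i (r_i + s_i) \prod_i r_i!\, s_i!}, \]
  with one index \<open>ps = [(r\<^sub>1, s\<^sub>1), \<dots>, (r\<^sub>k, s\<^sub>k)]\<close> for each summand. Words of length greater than
  \<open>m\<close> are left out; on a Lie algebra of nilpotency step \<open>m\<close> these are all zero.\<close>

definition bch :: "('a \<Rightarrow> 'a \<Rightarrow> 'a) \<Rightarrow> nat \<Rightarrow> 'a \<Rightarrow> 'a \<Rightarrow> 'a::real_vector" where
  "bch lie m x y =
    (\<Sum>ps \<in> bch_indices m.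
      ((- 1) ^ (length ps - 1) /
        (real (length ps) * real (\<Sum>(r, s)\<leftarrow>ps. r + s) * (\<Prod>(r, s)\<leftarrow>ps. fact r * fact s)))
      *\<^sub>R nested_bracket lie (concat (map (\<lambda>(r, s). replicate r x @ replicate s y) ps)))"

lemma finite_bch_indices: "finite (bch_indices m)"
proof (rule finite_subset)
  show "bch_indices m \<subseteq> {ps. set ps \<subseteq> {..m} \<times> {..m} \<and> length ps \<le> m}"
  proof
    fix ps assume "ps \<in> bch_indices m"
    then have pos: "\<forall>p \<in> set ps. fst p + snd p > 0"
      and le: "(\<Sum>(r, s)\<leftarrow>ps. r + s) \<le> m"
      by (auto simp: bch_indices_def)
    have "set ps \<subseteq> {..m} \<times> {..m}"
    proof
      fix p assume "p \<in> set ps"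
      then have "(\<lambda>(r, s). r + s) p \<le> (\<Sum>(r, s)\<leftarrow>ps. r + s)"
        by (intro member_le_sum_list) auto
      with le show "p \<in> {..m} \<times> {..m}" by (cases p) auto
    qed
    moreover have "length ps \<le> (\<Sum>(r, s)\<leftarrow>ps. r + s)"
      using pos by (induction ps) (auto simp: case_prod_beta)
    ultimately show "ps \<in> {ps. set ps \<subseteq> {..m} \<times> {..m} \<and> length ps \<le> m}"
      using le by simp
  qed
  show "finite {ps. set ps \<subseteq> {..m} \<times> {..m} \<and> length ps \<le> m}"
    by (rule finite_lists_length_le) simp
qed

section \<open>Stratified groups\<close>

text \<open>A stratified group is identified with its Lie algebra through the exponential map, so it is
  the vector space \<open>'a\<close> with a Lie bracket \<open>lie\<close>, and \<open>bch lie \<iota>\<close> is the group product. A vector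
  \<open>v\<close> stands for the left invariant vector field whose value at the unit \<open>0\<close> is \<open>v\<close>; the layer
  \<open>V j\<close> is thus also the \<open>j\<close>-th layer of the Lie algebra of left invariant fields.
  The set \<open>V 0\<close> plays no role.\<close>

locale stratified_group =
  fixes V :: "nat \<Rightarrow> 'a::euclidean_space set" and \<iota> :: nat and lie :: "'a \<Rightarrow> 'a \<Rightarrow> 'a"
  assumes subspace_layer: "1 \<le> j \<Longrightarrow> subspace (V j)"
    and direct_sum: "\<exists>!f. f \<in> (\<Pi>\<^sub>E j\<in>{1..\<iota>}. V j) \<and> (\<Sum>j=1..\<iota>. f j) = x"
    and step_pos: "1 \<le> \<iota>"
    and last_layer: "V \<iota> \<noteq> {0}"
    and layer_beyond: "\<iota> < j \<Longrightarrow> V j = {0}"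
    and bilinear_lie: "bilinear lie"
    and lie_self: "lie x x = 0"
    and jacobi: "lie x (lie y z) + lie y (lie z x) + lie z (lie x y) = 0"
    and stratified: "1 \<le> j \<Longrightarrow> span {lie x y | x y. x \<in> V 1 \<and> y \<in> V j} = V (Suc j)"

definition layer_components :: "(nat \<Rightarrow> 'a::real_vector set) \<Rightarrow> nat \<Rightarrow> 'a \<Rightarrow> nat \<Rightarrow> 'a" where
  "layer_components V \<iota> x = (THE f. f \<in> (\<Pi>\<^sub>E j\<in>{1..\<iota>}. V j) \<and> (\<Sum>j=1..\<iota>. f j) = x)"

definition dilation :: "(nat \<Rightarrow> 'a::real_vector set) \<Rightarrow> nat \<Rightarrow> real \<Rightarrow> 'a \<Rightarrow> 'a" where
  "dilation V \<iota> r x = (\<Sum>j=1..\<iota>. r ^ j *\<^sub>R layer_components V \<iota> x j)"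

text \<open>The scalar product is the one of the type \<open>'a\<close>, and \<open>e 0, \<dots>, e (n - 1)\<close> with
  \<open>n = DIM('a)\<close> is the adapted basis that it makes orthonormal.\<close>

definition adapted_orthonormal_basis ::
    "(nat \<Rightarrow> 'a::euclidean_space set) \<Rightarrow> nat \<Rightarrow> (nat \<Rightarrow> 'a) \<Rightarrow> bool" where
  "adapted_orthonormal_basis V \<iota> e \<longleftrightarrow>
    (\<forall>i<DIM('a). \<forall>k<DIM('a). e i \<bullet> e k = (if i = k then 1 else 0)) \<and>
    (\<forall>j\<in>{1..\<iota>}. span (e ` {(\<Sum>i=1..<j. dim (V i))..<(\<Sum>i=1..j. dim (V i))}) = V j)"

text \<open>The library's closed ball for a distance \<open>d\<close> is \<open>Metric_space.mcball UNIV d\<close>.\<close>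

definition homogeneous_distance ::
    "(nat \<Rightarrow> 'a::euclidean_space set) \<Rightarrow> nat \<Rightarrow> ('a \<Rightarrow> 'a \<Rightarrow> 'a) \<Rightarrow> ('a \<Rightarrow> 'a \<Rightarrow> real) \<Rightarrow> bool" where
  "homogeneous_distance V \<iota> lie d \<longleftrightarrow>
    Metric_space UNIV d \<and>
    continuous_on UNIV (\<lambda>(x, y). d x y) \<and>
    (\<forall>x y z. d (bch lie \<iota> z x) (bch lie \<iota> z y) = d x y) \<and>
    (\<forall>x y. \<forall>r>0. d (dilation V \<iota> r x) (dilation V \<iota> r y) = r * d x y)"

section \<open>Hausdorff measure and \<open>\<beta>\<close>\<close>

text \<open>The factor \<open>unit_ball_vol k / 2 ^ k\<close> is the normalization for which the \<open>k\<close>-dimensional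
  Hausdorff measure is Lebesgue measure on \<open>k\<close>-dimensional linear subspaces. The empty set is
  treated apart because \<open>0 ^ 0 = 1\<close>.\<close>

definition hausdorff_gauge :: "nat \<Rightarrow> 'a::metric_space set \<Rightarrow> ennreal" where
  "hausdorff_gauge k C =
    (if C = {} then 0 else ennreal (unit_ball_vol (real k) * (diameter C / 2) ^ k))"

definition hausdorff_measure :: "nat \<Rightarrow> 'a::metric_space set \<Rightarrow> ennreal" where
  "hausdorff_measure k A =
    (SUP \<delta> \<in> {0<..}.
      INF C \<in> {C :: nat \<Rightarrow> 'a set.
          A \<subseteq> (\<Union>i. C i) \<and> (\<forall>i. bounded (C i) \<and> diameter (C i) \<le> \<delta>)}.
        (\<Sum>i. hausdorff_gauge k (C i)))"

definition higher_layers :: "(nat \<Rightarrow> 'a::euclidean_space set) \<Rightarrow> nat \<Rightarrow> 'a set" where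
  "higher_layers V \<iota> = span (\<Union>j\<in>{2..\<iota>}. V j)"

definition vertical_hyperplane ::
    "(nat \<Rightarrow> 'a::euclidean_space set) \<Rightarrow> nat \<Rightarrow> 'a \<Rightarrow> 'a set" where
  "vertical_hyperplane V \<iota> \<nu> =
    {h + w | h w. h \<in> V 1 \<and> orthogonal \<nu> h \<and> w \<in> higher_layers V \<iota>}"

text \<open>The maximum in \<open>\<beta>\<close> is written as a supremum in the extended nonnegative reals, which is
  equal to the maximum as soon as the latter exists.\<close>

definition \<beta> ::
    "(nat \<Rightarrow> 'a::euclidean_space set) \<Rightarrow> nat \<Rightarrow> ('a \<Rightarrow> 'a \<Rightarrow> real) \<Rightarrow> 'a \<Rightarrow> ennreal" where
  "\<beta> V \<iota> d \<nu> =
    (SUP z \<in> Metric_space.mcball UNIV d 0 1.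
      hausdorff_measure (DIM('a) - 1)
        (Metric_space.mcball UNIV d z 1 \<inter> vertical_hyperplane V \<iota> \<nu>))"

section \<open>Vertical symmetry\<close>

definition orthogonal_projection :: "'a::euclidean_space set \<Rightarrow> 'a \<Rightarrow> 'a" where
  "orthogonal_projection S x = (THE p. p \<in> S \<and> (\<forall>s\<in>S. orthogonal (x - p) s))"

text \<open>Maps defined on the subspace \<open>S\<close> only are represented as extensional functions, so that
  the restriction of a map \<open>T\<close> of the whole space to \<open>S\<close> is \<open>restrict T S\<close>. Surjectivity of a
  linear isometry of \<open>S\<close> is automatic in finite dimension.\<close>

definition orthogonal_group :: "'a::euclidean_space set \<Rightarrow> ('a \<Rightarrow> 'a) set" where
  "orthogonal_group S =
    {T \<in> S \<rightarrow>\<^sub>E S. (\<forall>x\<in>S. \<forall>y\<in>S. T (x + y) = T x + T y) \<and>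
      (\<forall>c. \<forall>x\<in>S. T (c *\<^sub>R x) = c *\<^sub>R T x) \<and> (\<forall>x\<in>S. norm (T x) = norm x)}"

definition vertical_extensions ::
    "(nat \<Rightarrow> 'a::euclidean_space set) \<Rightarrow> nat \<Rightarrow> ('a \<Rightarrow> 'a) set \<Rightarrow> ('a \<Rightarrow> 'a) set" where
  "vertical_extensions V \<iota> F =
    {T. linear T \<and> bij T \<and> (\<forall>w\<in>higher_layers V \<iota>. T w = w) \<and> restrict T (V 1) \<in> F}"

definition vertically_symmetric ::
    "(nat \<Rightarrow> 'a::euclidean_space set) \<Rightarrow> nat \<Rightarrow> ('a \<Rightarrow> 'a \<Rightarrow> real) \<Rightarrow> bool" where
  "vertically_symmetric V \<iota> d \<longleftrightarrow>
    (\<exists>F. F \<subseteq> orthogonal_group (V 1) \<and>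
      (\<forall>\<nu>\<^sub>1\<in>V 1. \<forall>\<nu>\<^sub>2\<in>V 1. norm \<nu>\<^sub>1 = norm \<nu>\<^sub>2 \<longrightarrow> (\<exists>T\<in>F. T \<nu>\<^sub>1 = \<nu>\<^sub>2)) \<and>
      (\<exists>r\<^sub>0>0.
        orthogonal_projection (V 1) ` Metric_space.mcball UNIV d 0 1 =
          Metric_space.mcball UNIV d 0 1 \<inter> V 1 \<and>
        Metric_space.mcball UNIV d 0 1 \<inter> V 1 = {h \<in> V 1. norm h \<le> r\<^sub>0}) \<and>
      (\<forall>T\<in>vertical_extensions V \<iota> F.
        T ` Metric_space.mcball UNIV d 0 1 = Metric_space.mcball UNIV d 0 1))"

end

theory Submission
  imports Defs
begin

text \<open>For a unit vector \<open>u\<close> of the first layer, left translation by \<open>- z\<close> carries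
  \<open>B(z, 1) \<inter> N(u)\<close> onto the slice \<open>{x \<in> B(0, 1). x \<bullet> u = - z \<bullet> u}\<close>. In an adapted basis
  the translation is triangular with ones on the diagonal, so it preserves volume, and hence also the
  Hausdorff measure of subsets of hyperplanes parallel to \<open>N(u)\<close>, which is proportional to the
  volume of cylinders over them; the value of the constant does not matter. Thus
  \<open>\<beta>(d, u)\<close> is the supremum of the Euclidean measures of the slices of \<open>B(0, 1)\<close> orthogonal
  to \<open>u\<close> at the heights \<open>- z \<bullet> u\<close> with \<open>z \<in> B(0, 1)\<close>. An element of \<open>O\<^sub>1\<close> that maps \<open>u\<close>
  to \<open>u'\<close> is a Euclidean isometry preserving \<open>B(0, 1)\<close>, so it permutes these slices.\<close>

section \<open>Hausdorff measure\<close>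

text \<open>All measure comparisons take place in the full space instead of inside a hyperplane. The
  group translation is composed with a Euclidean shift along \<open>u\<close>, so that it maps the
  hyperplane orthogonal to \<open>u\<close> to itself, and is then extended to the whole space by
  keeping the coordinate along \<open>u\<close>; this extension is the map whose volume is computed.
  Proportionality to cylinder volume rests on three properties of the Hausdorff measure: countable
  additivity on Borel sets, invariance under translations, and finiteness on bounded parts of a
  hyperplane, which gives the sigma-finiteness required by Fubini. Triangularity has an algebraic
  source. Every summand of the Baker-Campbell-Hausdorff product other than \<open>x\<close> and
  \<open>y\<close> is a genuine bracket, and a bracket with any element moves one step down the
  filtration by the sums of the layers from \<open>j\<close> on. Hence a change of \<open>x\<close>
  by an element of the \<open>j\<close>-th term changes the product by that same element, up to an
  error in the next term. The map is then a composition of shears, one for each basis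
  vector.\<close>

definition hausdorff_approx :: "nat \<Rightarrow> real \<Rightarrow> 'a::metric_space set \<Rightarrow> ennreal" where
  "hausdorff_approx k \<delta> A =
    (INF C \<in> {C :: nat \<Rightarrow> 'a set.
        A \<subseteq> (\<Union>i. C i) \<and> (\<forall>i. bounded (C i) \<and> diameter (C i) \<le> \<delta>)}.
      (\<Sum>i. hausdorff_gauge k (C i)))"

lemma hausdorff_measure_eq_SUP:
  "hausdorff_measure k A = (SUP \<delta> \<in> {0<..}. hausdorff_approx k \<delta> A)"
  by (simp add: hausdorff_measure_def hausdorff_approx_def)

lemma hausdorff_approx_le_measure:
  "0 < \<delta> \<Longrightarrow> hausdorff_approx k \<delta> A \<le> hausdorff_measure k A"
  unfolding hausdorff_measure_eq_SUP by (intro SUP_upper) simp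

lemma hausdorff_approx_le:
  assumes "A \<subseteq> (\<Union>i. C i)" "\<And>i. bounded (C i)" "\<And>i. diameter (C i) \<le> \<delta>"
  shows "hausdorff_approx k \<delta> A \<le> (\<Sum>i. hausdorff_gauge k (C i))"
  unfolding hausdorff_approx_def using assms by (intro INF_lower) auto

lemma hausdorff_approx_less_obtain:
  assumes "hausdorff_approx k \<delta> A < c"
  obtains C where "A \<subseteq> (\<Union>i. C i)" "\<And>i. bounded (C i)" "\<And>i. diameter (C i) \<le> \<delta>"
    "(\<Sum>i. hausdorff_gauge k (C i)) < c"
  using assms unfolding hausdorff_approx_def INF_less_iff by blast

lemma hausdorff_approx_mono:
  assumes "A \<subseteq> B" "\<delta> \<le> \<epsilon>"
  shows "hausdorff_approx k \<epsilon> A \<le> hausdorff_approx k \<delta> B"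
  unfolding hausdorff_approx_def
proof (rule INF_superset_mono)
  show "{C :: nat \<Rightarrow> 'a set. B \<subseteq> \<Union> (range C) \<and> (\<forall>i. bounded (C i) \<and> diameter (C i) \<le> \<delta>)} \<subseteq>
      {C. A \<subseteq> \<Union> (range C) \<and> (\<forall>i. bounded (C i) \<and> diameter (C i) \<le> \<epsilon>)}"
  proof
    fix C :: "nat \<Rightarrow> 'a set"
    assume "C \<in> {C. B \<subseteq> \<Union> (range C) \<and> (\<forall>i. bounded (C i) \<and> diameter (C i) \<le> \<delta>)}"
    then have C: "B \<subseteq> \<Union> (range C)" "\<And>i. bounded (C i)" "\<And>i. diameter (C i) \<le> \<delta>"
      by auto
    have "A \<subseteq> \<Union> (range C)" using C(1) assms(1) by (rule subset_trans[rotated])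
    moreover have "diameter (C i) \<le> \<epsilon>" for i using C(3) assms(2) by (rule order_trans)
    ultimately show "C \<in> {C. A \<subseteq> \<Union> (range C) \<and> (\<forall>i. bounded (C i) \<and> diameter (C i) \<le> \<epsilon>)}"
      using C(2) by simp
  qed
qed simp

lemma hausdorff_measure_mono:
  "A \<subseteq> B \<Longrightarrow> hausdorff_measure k A \<le> hausdorff_measure k B"
  unfolding hausdorff_measure_eq_SUP by (intro SUP_mono) (blast intro: hausdorff_approx_mono)

lemma hausdorff_approx_finite_cover:
  fixes D :: "'b \<Rightarrow> 'a::metric_space set"
  assumes "finite I" "A \<subseteq> (\<Union>i\<in>I. D i)" "0 \<le> \<delta>"
    and "\<And>i. i \<in> I \<Longrightarrow> bounded (D i)" "\<And>i. i \<in> I \<Longrightarrow> diameter (D i) \<le> \<delta>"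
  shows "hausdorff_approx k \<delta> A \<le> (\<Sum>i\<in>I. hausdorff_gauge k (D i))"
proof -
  obtain h where h: "bij_betw h {0..<card I} I"
    using ex_bij_betw_nat_finite[OF \<open>finite I\<close>] by blast
  \<comment> \<open>Padding with empty sets is free because the gauge of \<open>{}\<close> is 0 by a
    clause of its own, also for \<open>k = 0\<close>. Their diameter is 0, whence the assumption
    \<open>0 \<le> \<delta>\<close>.\<close>
  define C where "C i = (if i < card I then D (h i) else {})" for i
  have hI: "h i \<in> I" if "i < card I" for i
    using h that by (auto simp: bij_betw_def)
  have "A \<subseteq> (\<Union>i. C i)"
  proof
    fix x assume "x \<in> A"
    then obtain i where i: "i \<in> I" "x \<in> D i" using assms by auto
    then obtain n where "n < card I" "h n = i" using h by (force simp: bij_betw_def)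
    with i show "x \<in> (\<Union>i. C i)" by (auto simp: C_def intro!: exI[of _ n])
  qed
  then have "hausdorff_approx k \<delta> A \<le> (\<Sum>i. hausdorff_gauge k (C i))"
    by (rule hausdorff_approx_le) (use assms hI in \<open>auto simp: C_def\<close>)
  also have "\<dots> = (\<Sum>i<card I. hausdorff_gauge k (C i))"
    by (intro suminf_finite) (auto simp: C_def hausdorff_gauge_def)
  also have "\<dots> = (\<Sum>i\<in>{0..<card I}. hausdorff_gauge k (D (h i)))"
    by (intro sum.cong) (auto simp: C_def)
  also have "\<dots> = (\<Sum>i\<in>I. hausdorff_gauge k (D i))"
    by (rule sum.reindex_bij_betw[OF h])
  finally show ?thesis .
qed

lemma hausdorff_measure_empty [simp]: "hausdorff_measure k {} = 0"
proof -
  have "hausdorff_approx k \<delta> ({}::'a set) \<le> 0" if "0 < \<delta>" for \<delta>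
    using hausdorff_approx_finite_cover[of "{}" "{}" "\<lambda>_. {}" \<delta> k] that by simp
  then show ?thesis
    unfolding hausdorff_measure_eq_SUP by (simp add: le_zero_eq[symmetric] SUP_le_iff del: le_zero_eq)
qed

text \<open>Near-optimal covers of the pieces, the \<open>n\<close>-th one with slack
  \<open>e / 2 ^ (n + 1)\<close>, are merged into one sequence by the pairing function; the slacks
  add up to \<open>e\<close>.\<close>

lemma hausdorff_approx_UN_le:
  assumes "0 < \<delta>"
  shows "hausdorff_approx k \<delta> (\<Union>i. A i) \<le> (\<Sum>i. hausdorff_approx k \<delta> (A i))"
proof (rule ennreal_le_epsilon)
  fix e :: real assume e: "0 < e" and fin: "(\<Sum>i. hausdorff_approx k \<delta> (A i)) < top"
  have "hausdorff_approx k \<delta> (A n) < hausdorff_approx k \<delta> (A n) + e * (1/2)^Suc n" for n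
    using e fin by (auto simp: less_top dest!: ennreal_suminf_lessD)
  then have "\<exists>C. A n \<subseteq> (\<Union>i. C i) \<and> (\<forall>i. bounded (C i) \<and> diameter (C i) \<le> \<delta>) \<and>
      (\<Sum>i. hausdorff_gauge k (C i)) \<le> hausdorff_approx k \<delta> (A n) + e * (1/2)^Suc n" for n
    by (rule hausdorff_approx_less_obtain) (blast intro: less_imp_le)
  then obtain B where B: "\<And>n. A n \<subseteq> (\<Union>i. B n i)"
      "\<And>n i. bounded (B n i)" "\<And>n i. diameter (B n i) \<le> \<delta>"
    and le: "\<And>n. (\<Sum>i. hausdorff_gauge k (B n i)) \<le> hausdorff_approx k \<delta> (A n) + e * (1/2)^Suc n"
    by metis
  define C where "C = case_prod B o prod_decode"
  have "(\<Union>i. A i) \<subseteq> (\<Union>i. C i)"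
    using B(1) by (auto simp: C_def subset_eq) (metis prod.case prod_encode_inverse)
  then have "hausdorff_approx k \<delta> (\<Union>i. A i) \<le> (\<Sum>i. hausdorff_gauge k (C i))"
    by (rule hausdorff_approx_le) (use B in \<open>auto simp: C_def split_def\<close>)
  also have "\<dots> = (\<Sum>n. \<Sum>i. hausdorff_gauge k (B n i))"
    unfolding C_def comp_def by (intro suminf_ennreal_2dimen) auto
  also have "\<dots> \<le> (\<Sum>n. hausdorff_approx k \<delta> (A n) + e * (1/2) ^ Suc n)"
    by (intro suminf_le allI le) auto
  also have "\<dots> = (\<Sum>n. hausdorff_approx k \<delta> (A n)) + (\<Sum>n. ennreal e * ennreal ((1/2) ^ Suc n))"
    using e by (subst suminf_add[symmetric])
      (auto simp del: ennreal_suminf_cmult simp add: ennreal_mult[symmetric])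
  also have "\<dots> = (\<Sum>n. hausdorff_approx k \<delta> (A n)) + e"
    unfolding ennreal_suminf_cmult
    by (subst suminf_ennreal_eq[OF zero_le_power power_half_series]) auto
  finally show "hausdorff_approx k \<delta> (\<Union>i. A i) \<le> (\<Sum>n. hausdorff_approx k \<delta> (A n)) + e" .
qed

section \<open>Subadditivity, and additivity on sets at positive distance\<close>

lemma hausdorff_measure_UN_le:
  "hausdorff_measure k (\<Union>i::nat. A i) \<le> (\<Sum>i. hausdorff_measure k (A i))"
  unfolding hausdorff_measure_eq_SUP[of k "\<Union>i. A i"]
proof (rule SUP_least)
  fix \<delta> :: real assume "\<delta> \<in> {0<..}"
  then have "hausdorff_approx k \<delta> (\<Union>i. A i) \<le> (\<Sum>i. hausdorff_approx k \<delta> (A i))"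
    by (intro hausdorff_approx_UN_le) simp
  also have "\<dots> \<le> (\<Sum>i. hausdorff_measure k (A i))"
    using \<open>\<delta> \<in> {0<..}\<close> by (intro suminf_le hausdorff_approx_le_measure) auto
  finally show "hausdorff_approx k \<delta> (\<Union>i. A i) \<le> (\<Sum>i. hausdorff_measure k (A i))" .
qed

lemma outer_measure_space_hausdorff: "outer_measure_space UNIV (hausdorff_measure k)"
  unfolding outer_measure_space_def positive_def increasing_def countably_subadditive_def
  using hausdorff_measure_mono hausdorff_measure_UN_le by auto

lemma hausdorff_measure_Un_le:
  "hausdorff_measure k (A \<union> B) \<le> hausdorff_measure k A + hausdorff_measure k B"
proof -
  let ?D = "\<lambda>i::nat. if i = 0 then A else if i = 1 then B else {}"
  have "hausdorff_measure k (A \<union> B) = hausdorff_measure k (\<Union>i. ?D i)"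
    by (rule arg_cong[of _ _ "hausdorff_measure k"]) (auto split: if_splits)
  also have "\<dots> \<le> (\<Sum>i. hausdorff_measure k (?D i))"
    by (rule hausdorff_measure_UN_le)
  also have "\<dots> = (\<Sum>i\<in>{0,1}. hausdorff_measure k (?D i))"
    by (rule suminf_finite) auto
  finally show ?thesis by simp
qed

text \<open>A set of diameter less than \<open>\<epsilon>\<close> cannot meet both \<open>A\<close>
  and \<open>B\<close>, so a fine cover of the union splits into a cover of \<open>A\<close> and a
  cover of \<open>B\<close> with no member used twice.\<close>

lemma hausdorff_measure_separated:
  assumes "0 < \<epsilon>" and sep: "\<And>x y. x \<in> A \<Longrightarrow> y \<in> B \<Longrightarrow> \<epsilon> \<le> dist x y"
  shows "hausdorff_measure k A + hausdorff_measure k B \<le> hausdorff_measure k (A \<union> B)"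
proof -
  have key: "hausdorff_approx k \<delta> A + hausdorff_approx k \<delta> B \<le> hausdorff_approx k \<delta> (A \<union> B)"
    if "\<delta> < \<epsilon>" for \<delta>
    unfolding hausdorff_approx_def[of _ _ "A \<union> B"]
  proof (rule INF_greatest, clarify)
    fix C :: "nat \<Rightarrow> 'a set"
    assume C: "A \<union> B \<subseteq> (\<Union>i. C i)" "\<forall>i. bounded (C i) \<and> diameter (C i) \<le> \<delta>"
    have \<delta>: "0 \<le> \<delta>"
      using C(2) diameter_ge_0 order_trans by blast
    define P where "P i = (if C i \<inter> A = {} then {} else C i)" for i
    define Q where "Q i = (if C i \<inter> B = {} then {} else C i)" for i
    have "hausdorff_approx k \<delta> A \<le> (\<Sum>i. hausdorff_gauge k (P i))"
      by (rule hausdorff_approx_le) (use C \<delta> in \<open>auto simp: P_def\<close>, blast)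
    moreover have "hausdorff_approx k \<delta> B \<le> (\<Sum>i. hausdorff_gauge k (Q i))"
      by (rule hausdorff_approx_le) (use C \<delta> in \<open>auto simp: Q_def\<close>, blast)
    moreover have "hausdorff_gauge k (P i) + hausdorff_gauge k (Q i) \<le> hausdorff_gauge k (C i)" for i
    proof -
      have "C i \<inter> A = {} \<or> C i \<inter> B = {}"
      proof (rule ccontr)
        assume "\<not> ?thesis"
        then obtain x y where "x \<in> C i" "x \<in> A" "y \<in> C i" "y \<in> B" by auto
        with sep[of x y] C(2) diameter_bounded_bound[of "C i" x y] that show False
          by (meson leD le_less_trans order_trans)
      qed
      then show ?thesis by (auto simp: P_def Q_def hausdorff_gauge_def)
    qed
    then have "(\<Sum>i. hausdorff_gauge k (P i)) + (\<Sum>i. hausdorff_gauge k (Q i))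
        \<le> (\<Sum>i. hausdorff_gauge k (C i))"
      by (subst suminf_add) (auto intro!: suminf_le)
    ultimately show "hausdorff_approx k \<delta> A + hausdorff_approx k \<delta> B
        \<le> (\<Sum>i. hausdorff_gauge k (C i))"
      by (meson add_mono order_trans)
  qed
  have "hausdorff_measure k A + hausdorff_measure k B =
      (SUP \<delta> \<in> {0<..}. hausdorff_approx k \<delta> A + hausdorff_approx k \<delta> B)"
    unfolding hausdorff_measure_eq_SUP
  \<comment> \<open>Both approximations grow as the scale shrinks, so the smaller of two scales
    serves both and the sum of the suprema is the supremum of the sums.\<close>
  proof (rule SUP_add_directed_ennreal[symmetric])
    fix i j :: real assume "i \<in> {0<..}" "j \<in> {0<..}"
    then show "\<exists>l\<in>{0<..}. hausdorff_approx k i A + hausdorff_approx k j B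
        \<le> hausdorff_approx k l A + hausdorff_approx k l B"
      by (intro bexI[of _ "min i j"] add_mono hausdorff_approx_mono) auto
  qed
  also have "\<dots> \<le> hausdorff_measure k (A \<union> B)"
  proof (rule SUP_least)
    fix \<delta> :: real assume "\<delta> \<in> {0<..}"
    define \<delta>' where "\<delta>' = min \<delta> (\<epsilon> / 2)"
    have \<delta>': "0 < \<delta>'" "\<delta>' \<le> \<delta>" "\<delta>' < \<epsilon>"
      using \<open>0 < \<epsilon>\<close> \<open>\<delta> \<in> {0<..}\<close> by (auto simp: \<delta>'_def)
    have "hausdorff_approx k \<delta> A + hausdorff_approx k \<delta> B
        \<le> hausdorff_approx k \<delta>' A + hausdorff_approx k \<delta>' B"
      using \<delta>' by (intro add_mono hausdorff_approx_mono) auto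
    also have "\<dots> \<le> hausdorff_approx k \<delta>' (A \<union> B)" using key \<delta>' by simp
    also have "\<dots> \<le> hausdorff_measure k (A \<union> B)"
      using \<delta>' by (intro hausdorff_approx_le_measure)
    finally show "hausdorff_approx k \<delta> A + hausdorff_approx k \<delta> B \<le> hausdorff_measure k (A \<union> B)" .
  qed
  finally show ?thesis .
qed

text \<open>The sets are added one at a time, so the gap between \<open>R N\<close> and its
  predecessors may tend to 0 with \<open>N\<close>, as it does for shells that accumulate at a
  closed set.\<close>

lemma hausdorff_measure_sum_separated:
  assumes "\<And>N. \<exists>\<epsilon>>0. \<forall>j<N. \<forall>x\<in>R j. \<forall>y\<in>R N. \<epsilon> \<le> dist x y"
  shows "(\<Sum>j<N. hausdorff_measure k (R j)) \<le> hausdorff_measure k (\<Union>j<N::nat. R j)"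
proof (induction N)
  case (Suc N)
  obtain \<epsilon> where "\<epsilon> > 0" "\<forall>j<N. \<forall>x\<in>R j. \<forall>y\<in>R N. \<epsilon> \<le> dist x y"
    using assms by blast
  then have "hausdorff_measure k (\<Union>j<N. R j) + hausdorff_measure k (R N)
      \<le> hausdorff_measure k ((\<Union>j<N. R j) \<union> R N)"
    by (intro hausdorff_measure_separated[of \<epsilon>]) auto
  moreover have "(\<Union>j<N. R j) \<union> R N = (\<Union>j<Suc N. R j)"
    by (auto simp: less_Suc_eq)
  ultimately have "hausdorff_measure k (\<Union>j<N. R j) + hausdorff_measure k (R N)
      \<le> hausdorff_measure k (\<Union>j<Suc N. R j)"
    by simp
  with add_right_mono[OF Suc.IH] show ?case
    unfolding sum.lessThan_Suc by (rule order_trans)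
qed simp

text \<open>Caratheodory's criterion. The part of \<open>X\<close> outside the closed set \<open>C\<close> is cut into shells
  according to the distance to \<open>C\<close>; every second shell is at positive distance from the previous
  ones, which makes the sum of the measures of the shells finite.\<close>

lemma closed_in_hausdorff_lambda_system:
  fixes C :: "'a::metric_space set"
  assumes "closed C"
  shows "C \<in> lambda_system UNIV UNIV (hausdorff_measure k)"
proof -
  let ?H = "hausdorff_measure k"
  \<comment> \<open>By convention \<open>infdist x {} = 0\<close>, which would make every
    \<open>A m\<close> empty; an empty \<open>C\<close> is settled directly at the end.\<close>
  have main: "?H (C \<inter> X) + ?H (X - C) \<le> ?H X" if "C \<noteq> {}" for X
  proof (rule ennreal_le_epsilon)
    fix \<epsilon> :: real assume fin: "?H X < top" and "0 < \<epsilon>"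
    define A where "A m = {x \<in> X. 1 / real (Suc m) \<le> infdist x C}" for m
    define R where "R m = A (Suc m) - A m" for m
    have RX: "R m \<subseteq> X" for m by (auto simp: R_def A_def)
    \<comment> \<open>The offset \<open>c\<close> selects the parity of the shells; it is used with
      0 and 1.\<close>
    have alt: "(\<Sum>j<N. ?H (R (2 * j + c))) \<le> ?H X" for N c
    proof -
      have "(\<Sum>j<N. ?H (R (2 * j + c))) \<le> ?H (\<Union>j<N. R (2 * j + c))"
      proof (rule hausdorff_measure_sum_separated)
        fix N
        \<comment> \<open>For \<open>j < N\<close>, points of \<open>R (2 * j + c)\<close> have
          distance at least \<open>1 / (2 * N + c)\<close> from \<open>C\<close>, while those of
          \<open>R (2 * N + c)\<close> are closer than \<open>1 / (2 * N + c + 1)\<close>. For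
          \<open>N = 0\<close> there is no \<open>j\<close>, and the fraction could be a division by
          0.\<close>
        let ?\<epsilon> = "1 / real (2 * N + c) - 1 / real (Suc (2 * N + c))"
        show "\<exists>\<epsilon>>0. \<forall>j<N. \<forall>x\<in>R (2 * j + c). \<forall>y\<in>R (2 * N + c). \<epsilon> \<le> dist x y"
        proof (cases "N = 0")
          case True then show ?thesis by (auto intro!: exI[of _ 1])
        next
          case False
          show ?thesis
          proof (intro exI conjI allI impI ballI)
            show "0 < ?\<epsilon>" using False by (simp add: divide_strict_left_mono)
            fix j x y assume j: "j < N" and x: "x \<in> R (2 * j + c)" and y: "y \<in> R (2 * N + c)"
            have "1 / real (2 * N + c) \<le> 1 / real (Suc (Suc (2 * j + c)))"
              using j by (intro divide_left_mono) auto
            also have "\<dots> \<le> infdist x C" using x by (auto simp: R_def A_def)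
            finally have "1 / real (2 * N + c) \<le> infdist x C" .
            moreover have "infdist y C < 1 / real (Suc (2 * N + c))"
              using y by (auto simp: R_def A_def)
            moreover have "infdist x C \<le> infdist y C + dist x y"
              by (rule infdist_triangle)
            ultimately show "?\<epsilon> \<le> dist x y" by linarith
          qed
        qed
      qed
      also have "\<dots> \<le> ?H X" using RX by (intro hausdorff_measure_mono) auto
      finally show ?thesis .
    qed
    have bnd: "(\<Sum>j<N. ?H (R j)) \<le> ?H X + ?H X" for N
    proof -
      have "(\<Sum>j<N. ?H (R j)) \<le> (\<Sum>j<2 * N. ?H (R j))"
        by (rule sum_mono2) auto
      also have "\<dots> = (\<Sum>j<N. ?H (R (2 * j + 0))) + (\<Sum>j<N. ?H (R (2 * j + 1)))"
        by (induction N) (auto simp: ac_simps)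
      also have "\<dots> \<le> ?H X + ?H X" by (intro add_mono alt)
      finally show ?thesis .
    qed
    have "(\<Sum>j. ?H (R j)) \<le> ?H X + ?H X"
      by (rule suminf_le_const) (use bnd in auto)
    also have "\<dots> < top" using fin by simp
    finally have "(\<Sum>j. ?H (R j)) < top" .
    moreover define r where "r j = enn2real (?H (R j))" for j
    have "?H (R j) \<le> ?H X" for j by (rule hausdorff_measure_mono[OF RX])
    then have r: "?H (R j) = ennreal (r j)" for j
      using fin le_less_trans unfolding r_def by (metis ennreal_enn2real)
    moreover have r0: "0 \<le> r j" for j by (simp add: r_def)
    ultimately have "summable r"
      by (intro summable_suminf_not_top) auto
    \<comment> \<open>The shells have finite total measure, so those beyond \<open>m\<close>
      contribute less than \<open>\<epsilon>\<close>. The remainder \<open>A m\<close> is at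
      positive distance from \<open>C\<close>.\<close>
    then obtain m where m: "norm (\<Sum>i. r (i + m)) < \<epsilon>"
      using suminf_exist_split[of \<epsilon> r] \<open>0 < \<epsilon>\<close> by auto
    have "(\<Sum>i. ?H (R (i + m))) = ennreal (\<Sum>i. r (i + m))"
      unfolding r using r0 \<open>summable r\<close> by (intro suminf_ennreal2) auto
    with m have tail: "(\<Sum>i. ?H (R (i + m))) \<le> ennreal \<epsilon>"
      by (auto intro!: ennreal_leI)
    have "X - C \<subseteq> A m \<union> (\<Union>i. R (i + m))"
    proof
      fix x assume x: "x \<in> X - C"
      then have "0 < infdist x C"
        using assms that in_closed_iff_infdist_zero infdist_nonneg
        by (metis DiffD2 order_le_imp_less_or_eq)
      then obtain n where "inverse (real (Suc n)) < infdist x C"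
        using reals_Archimedean by blast
      then have ex: "x \<in> A n" using x by (auto simp: A_def inverse_eq_divide)
      \<comment> \<open>Closedness of \<open>C\<close> puts every point of \<open>X - C\<close> into
        some \<open>A n\<close>. If the first such index exceeds \<open>m\<close>, the point lies in
        the shell just before that index.\<close>
      define l where "l = (LEAST n. x \<in> A n)"
      have l: "x \<in> A l" unfolding l_def using ex by (rule LeastI)
      show "x \<in> A m \<union> (\<Union>i. R (i + m))"
      proof (cases "l \<le> m")
        case True
        then have "1 / real (Suc m) \<le> 1 / real (Suc l)" by (intro divide_left_mono) auto
        with l show ?thesis by (auto simp: A_def)
      next
        case False
        then obtain i where i: "l = Suc (i + m)" by (metis add.commute less_natE not_le)
        then have "x \<notin> A (i + m)"
          using not_less_Least[of "i + m" "\<lambda>n. x \<in> A n"] by (auto simp: l_def)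
        with l i show ?thesis by (auto simp: R_def)
      qed
    qed
    then have "?H (X - C) \<le> ?H (A m \<union> (\<Union>i. R (i + m)))" by (rule hausdorff_measure_mono)
    also have "\<dots> \<le> ?H (A m) + ?H (\<Union>i. R (i + m))" by (rule hausdorff_measure_Un_le)
    also have "\<dots> \<le> ?H (A m) + \<epsilon>"
      by (intro add_left_mono order_trans[OF hausdorff_measure_UN_le tail])
    finally have "?H (C \<inter> X) + ?H (X - C) \<le> ?H (C \<inter> X) + ?H (A m) + \<epsilon>"
      by (simp add: add_left_mono add.assoc)
    also have "?H (C \<inter> X) + ?H (A m) \<le> ?H (C \<inter> X \<union> A m)"
    proof (rule hausdorff_measure_separated[of "1 / real (Suc m)"])
      fix x y assume "x \<in> C \<inter> X" "y \<in> A m"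
      then show "1 / real (Suc m) \<le> dist x y"
        using infdist_le[of x C y] by (auto simp: A_def dist_commute)
    qed simp
    also have "\<dots> \<le> ?H X" by (rule hausdorff_measure_mono) (auto simp: A_def)
    finally show "?H (C \<inter> X) + ?H (X - C) \<le> ?H X + \<epsilon>" by (simp add: add_right_mono)
  qed
  have "?H (C \<inter> X) + ?H ((UNIV - C) \<inter> X) = ?H X" for X
  proof (rule antisym)
    have eq: "(UNIV - C) \<inter> X = X - C" by auto
    show "?H (C \<inter> X) + ?H ((UNIV - C) \<inter> X) \<le> ?H X"
      using main[of X] by (cases "C = {}") (auto simp: eq)
    have "?H X \<le> ?H (C \<inter> X \<union> (UNIV - C) \<inter> X)" by (rule hausdorff_measure_mono) auto
    also have "\<dots> \<le> ?H (C \<inter> X) + ?H ((UNIV - C) \<inter> X)" by (rule hausdorff_measure_Un_le)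
    finally show "?H X \<le> ?H (C \<inter> X) + ?H ((UNIV - C) \<inter> X)" .
  qed
  then show ?thesis by (simp add: lambda_system_def)
qed

section \<open>The Hausdorff measure as a Borel measure\<close>

definition borel_hausdorff :: "nat \<Rightarrow> 'a::metric_space measure" where
  "borel_hausdorff k = measure_of UNIV (sets borel) (hausdorff_measure k)"

lemma space_borel_hausdorff [simp]: "space (borel_hausdorff k) = UNIV"
  by (simp add: borel_hausdorff_def space_measure_of_conv)

lemma sets_borel_hausdorff [simp, measurable_cong]: "sets (borel_hausdorff k) = sets borel"
  unfolding borel_hausdorff_def using sets.sigma_sets_eq[of borel] by (simp add: sets_measure_of_conv)

text \<open>\<open>measure_of\<close> yields the zero measure unless its function is countably
  additive, so the identity has content: Caratheodory makes the outer measure additive on its lambda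
  system, which contains the closed sets and therefore all Borel sets.\<close>

lemma emeasure_borel_hausdorff:
  assumes "A \<in> sets borel"
  shows "emeasure (borel_hausdorff k) A = hausdorff_measure k (A::'a::metric_space set)"
proof -
  let ?L = "lambda_system UNIV UNIV (hausdorff_measure k) :: 'a set set"
  have L: "measure_space UNIV ?L (hausdorff_measure k)"
    using sigma_algebra.caratheodory_lemma[OF sigma_algebra_Pow]
      outer_measure_space_hausdorff by (metis Pow_UNIV)
  then have sL: "sigma_algebra UNIV ?L" by (simp add: measure_space_def)
  have "sets borel \<subseteq> ?L"
    unfolding borel_eq_closed using closed_in_hausdorff_lambda_system
    by (simp add: sets_measure_of_conv) (intro sigma_algebra.sigma_sets_subset[OF sL], auto)
  then have "measure_space UNIV (sets borel) (hausdorff_measure k :: 'a set \<Rightarrow> _)"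
    using measure_down[OF L] sets.sigma_algebra_axioms[of borel] by auto
  then show ?thesis
    unfolding borel_hausdorff_def using assms
    by (intro emeasure_measure_of_sigma) (auto simp: measure_space_def)
qed

section \<open>Invariance under isometries\<close>

lemma hausdorff_measure_isometric_image_le:
  fixes f :: "'a::metric_space \<Rightarrow> 'b::metric_space"
  assumes "\<And>x y. dist (f x) (f y) = dist x y"
  shows "hausdorff_measure k (f ` A) \<le> hausdorff_measure k A"
  unfolding hausdorff_measure_eq_SUP
proof (rule SUP_mono, rule bexI)
  fix \<delta> :: real
  show "hausdorff_approx k \<delta> (f ` A) \<le> hausdorff_approx k \<delta> A"
    unfolding hausdorff_approx_def[of _ _ A]
  proof (rule INF_greatest, clarify)
    fix C :: "nat \<Rightarrow> 'a set"
    assume C: "A \<subseteq> (\<Union>i. C i)" "\<forall>i. bounded (C i) \<and> diameter (C i) \<le> \<delta>"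
    have d: "diameter (f ` S) = diameter S" for S
    proof -
      have "(\<lambda>(x, y). dist x y) ` (f ` S \<times> f ` S) = (\<lambda>(x, y). dist x y) ` (S \<times> S)"
        using assms by (force simp: image_iff)
      then show ?thesis unfolding diameter_def by simp
    qed
    have b: "bounded (f ` S)" if S: "bounded S" for S
    proof -
      obtain x e where "\<forall>y\<in>S. dist x y \<le> e" using S unfolding bounded_def by auto
      then show ?thesis unfolding bounded_def using assms by (intro exI[of _ "f x"] exI[of _ e]) auto
    qed
    have "hausdorff_approx k \<delta> (f ` A) \<le> (\<Sum>i. hausdorff_gauge k (f ` C i))"
      by (rule hausdorff_approx_le, simp_all add: image_UN[symmetric] C b d image_mono)
    then show "hausdorff_approx k \<delta> (f ` A) \<le> (\<Sum>i. hausdorff_gauge k (C i))"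
      by (simp add: hausdorff_gauge_def d cong: if_cong)
  qed
qed

lemma hausdorff_measure_isometric_image:
  assumes iso: "\<And>x y. dist (f x) (f y) = dist x y" and "bij f"
  shows "hausdorff_measure k (f ` A) = hausdorff_measure k A"
proof (rule antisym)
  have "dist (inv f x) (inv f y) = dist x y" for x y
    using iso[of "inv f x" "inv f y"] \<open>bij f\<close> by (simp add: bij_is_surj surj_f_inv_f)
  then have "hausdorff_measure k (inv f ` f ` A) \<le> hausdorff_measure k (f ` A)"
    by (rule hausdorff_measure_isometric_image_le)
  then show "hausdorff_measure k A \<le> hausdorff_measure k (f ` A)"
    using \<open>bij f\<close> by (simp add: bij_is_inj)
qed (rule hausdorff_measure_isometric_image_le[OF iso])

lemma hausdorff_measure_translation:
  fixes A :: "'a::real_normed_vector set"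
  shows "hausdorff_measure k ((+) a ` A) = hausdorff_measure k A"
  by (rule hausdorff_measure_isometric_image) (auto simp: bij_plus_right)

section \<open>Hausdorff measure on hyperplanes\<close>

text \<open>In an orthonormal basis of the hyperplane, a grid of mesh \<open>1 / m\<close> covers
  the ball by at most a constant times \<open>m ^ k\<close> cells of diameter at most
  \<open>k / m\<close>. The two powers of \<open>m\<close> cancel in the sum of the gauges, leaving
  a bound independent of the scale.\<close>

lemma hausdorff_measure_hyperplane_finite:
  fixes u :: "'a::euclidean_space"
  assumes "u \<noteq> 0"
  shows "hausdorff_measure (DIM('a) - 1) ({x. u \<bullet> x = 0} \<inter> cball 0 (real r)) < top"
proof -
  define N where "N = {x. u \<bullet> x = 0}"
  define k where "k = DIM('a) - 1"
  have "subspace N" "dim N = k"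
    using assms by (simp_all add: N_def k_def subspace_hyperplane dim_hyperplane)
  then obtain B where B: "pairwise orthogonal B" "\<And>b. b \<in> B \<Longrightarrow> norm b = 1"
      "independent B" "card B = k" "span B = N"
    by (metis orthonormal_basis_subspace)
  have finB: "finite B" using B(3) independent_imp_finite by blast
  \<comment> \<open>The number of cells is \<open>(2 * r * m + 1) ^ k\<close>, at most
    \<open>(3 * (r + 1) * m) ^ k\<close>; multiplying by \<open>(k / m / 2) ^ k\<close> removes
    \<open>m\<close>.\<close>
  define M where "M = ennreal (unit_ball_vol k * (3 * (real r + 1) * k / 2) ^ k)"
  have "hausdorff_approx k \<delta> (N \<inter> cball 0 (real r)) \<le> M" if \<delta>: "0 < \<delta>" for \<delta>
  proof -
    obtain m0 :: nat where "k / \<delta> < m0" using reals_Archimedean2 by blast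
    define m where "m = Suc m0"
    have m: "0 < m" "k / m \<le> \<delta>"
      using \<open>k / \<delta> < m0\<close> \<delta> by (auto simp: m_def field_simps)
    define I where "I = (\<Pi>\<^sub>E b\<in>B. {.. 2 * r * m})"
    define D where
      \<comment> \<open>The function \<open>g\<close> numbers the cells. Adding \<open>r\<close>
        makes all coordinates of points of the ball nonnegative, so the numbers are naturals up to
        \<open>2 * r * m\<close>.\<close>
      "D g = {x \<in> N. \<forall>b\<in>B. real (g b) / m \<le> x \<bullet> b + r \<and> x \<bullet> b + r \<le> (real (g b) + 1) / m}" for g
    have dist_D: "norm (x - y) \<le> k / m" if "x \<in> D g" "y \<in> D g" for x y g
    proof -
      have "x - y \<in> span B"
        using that \<open>subspace N\<close> B(5) by (auto simp: D_def subspace_diff)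
      then have "x - y = (\<Sum>b\<in>B. ((x - y) \<bullet> b) *\<^sub>R b)"
        using orthonormal_basis_expand[OF B(1,2) _ finB] by simp
      then have "norm (x - y) \<le> (\<Sum>b\<in>B. norm (((x - y) \<bullet> b) *\<^sub>R b))"
        by (metis norm_sum)
      also have "\<dots> \<le> (\<Sum>b\<in>B. 1 / m)"
      proof (rule sum_mono)
        fix b assume "b \<in> B"
        then have "\<bar>x \<bullet> b - y \<bullet> b\<bar> \<le> (real (g b) + 1) / m - real (g b) / m"
          using that unfolding D_def by fastforce
        then show "norm (((x - y) \<bullet> b) *\<^sub>R b) \<le> 1 / m"
          using B(2)[OF \<open>b \<in> B\<close>] by (simp add: inner_diff_left diff_divide_distrib[symmetric])
      qed
      finally show ?thesis using B(4) by simp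
    qed
    have cover: "N \<inter> cball 0 (real r) \<subseteq> (\<Union>g\<in>I. D g)"
    proof
      fix x assume x: "x \<in> N \<inter> cball 0 (real r)"
      define g where "g = restrict (\<lambda>b. nat \<lfloor>m * (x \<bullet> b + r)\<rfloor>) B"
      have *: "0 \<le> x \<bullet> b + r" "x \<bullet> b + r \<le> 2 * r" if "b \<in> B" for b
        using Cauchy_Schwarz_ineq2[of x b] B(2)[OF that] x by auto
      have "g \<in> I"
      proof (unfold I_def, rule PiE_I)
        fix b assume b: "b \<in> B"
        have "m * (x \<bullet> b + r) \<le> m * real (2 * r)"
          using *[OF b] by (intro mult_left_mono) (auto simp del: of_nat_mult)
        also have "\<dots> = real_of_int (int (2 * r * m))" by simp
        finally have "\<lfloor>m * (x \<bullet> b + r)\<rfloor> \<le> int (2 * r * m)" by linarith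
        then show "g b \<in> {.. 2 * r * m}" using b by (simp add: g_def nat_le_iff)
      qed (simp add: g_def)
      moreover have "x \<in> D g"
      proof -
        have "real (g b) / m \<le> x \<bullet> b + r \<and> x \<bullet> b + r \<le> (real (g b) + 1) / m" if b: "b \<in> B" for b
        proof -
          have "0 \<le> m * (x \<bullet> b + r)" using *[OF b] by simp
          then have "real (g b) = real_of_int \<lfloor>m * (x \<bullet> b + r)\<rfloor>"
            using b by (simp add: g_def)
          then have "real (g b) \<le> m * (x \<bullet> b + r)" "m * (x \<bullet> b + r) \<le> real (g b) + 1"
            by linarith+
          then show ?thesis using m by (simp add: field_simps)
        qed
        then show ?thesis using x by (simp add: D_def)
      qed
      ultimately show "x \<in> (\<Union>g\<in>I. D g)" by blast
    qed
    have diam: "diameter (D g) \<le> k / m" for g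
      by (rule diameter_le) (use dist_D in auto)
    have bdd: "bounded (D g)" for g
    proof (cases "D g = {}")
      case False
      then obtain y where "y \<in> D g" by blast
      then show ?thesis
        using dist_D[of y g] by (auto simp: bounded_def dist_norm)
    qed simp
    have finI: "finite I" using finB by (simp add: I_def finite_PiE)
    have "hausdorff_approx k \<delta> (N \<inter> cball 0 (real r)) \<le> (\<Sum>g\<in>I. hausdorff_gauge k (D g))"
      using m \<delta> by (intro hausdorff_approx_finite_cover finI cover bdd order_trans[OF diam]) auto
    also have "\<dots> \<le> (\<Sum>g\<in>I. ennreal (unit_ball_vol k * (k / m / 2) ^ k))"
      unfolding hausdorff_gauge_def
      using diam by (intro sum_mono)
        (auto intro!: ennreal_leI mult_left_mono power_mono divide_right_mono diameter_ge_0[OF bdd])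
    also have "\<dots> = ennreal (real (card I) * (unit_ball_vol k * (k / m / 2) ^ k))"
      by (simp add: ennreal_mult ennreal_of_nat_eq_real_of_nat)
    also have "\<dots> \<le> M"
      unfolding M_def
    proof (rule ennreal_leI)
      have "card I = (2 * r * m + 1) ^ k"
        using finB B(4) by (simp add: I_def card_PiE)
      also have "\<dots> \<le> (3 * (r + 1) * m) ^ k"
        using m by (intro power_mono) (auto simp: algebra_simps)
      finally have "real (card I) \<le> real ((3 * (r + 1) * m) ^ k)"
        by (rule of_nat_mono)
      then have "real (card I) \<le> (3 * (real r + 1) * m) ^ k"
        by (simp add: add.commute)
      then have "real (card I) * (unit_ball_vol k * (k / m / 2) ^ k)
          \<le> (3 * (real r + 1) * m) ^ k * (unit_ball_vol k * (k / m / 2) ^ k)"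
        by (intro mult_right_mono) auto
      also have "\<dots> = unit_ball_vol k * ((3 * (real r + 1) * m) * (k / m / 2)) ^ k"
        by (simp only: power_mult_distrib ac_simps)
      also have "(3 * (real r + 1) * m) * (k / m / 2) = 3 * (real r + 1) * k / 2"
        using m by simp
      finally show "real (card I) * (unit_ball_vol k * (k / m / 2) ^ k)
          \<le> unit_ball_vol k * (3 * (real r + 1) * k / 2) ^ k" .
    qed
    finally show ?thesis .
  qed
  then have "hausdorff_measure k (N \<inter> cball 0 (real r)) \<le> M"
    unfolding hausdorff_measure_eq_SUP by (intro SUP_least) simp
  also have "\<dots> < top" by (simp add: M_def)
  finally show ?thesis by (simp add: N_def k_def)
qed

lemma nn_integral_lborel_translation:
  fixes f :: "'a::euclidean_space \<Rightarrow> ennreal"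
  assumes [measurable]: "f \<in> borel_measurable borel"
  shows "(\<integral>\<^sup>+x. f (x + a) \<partial>lborel) = (\<integral>\<^sup>+x. f x \<partial>lborel)"
proof -
  have "(\<integral>\<^sup>+x. f x \<partial>lborel) = (\<integral>\<^sup>+x. f x \<partial>distr lborel borel ((+) a))"
    by (simp add: lborel_distr_plus)
  also have "\<dots> = (\<integral>\<^sup>+x. f (x + a) \<partial>lborel)"
    by (subst nn_integral_distr) (auto simp: add.commute)
  finally show ?thesis ..
qed

text \<open>Up to a constant, \<open>hausdorff_measure (DIM('a) - 1)\<close> on the hyperplane orthogonal to \<open>u\<close> is
  the volume of the cylinder of height 1. This is the uniqueness of Haar measure: the integral of
  \<open>indicator A (y + P x) * indicator B x\<close> over \<open>y\<close> in the hyperplane and \<open>x\<close> in the space is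
  computed in two ways, the second after the substitution \<open>x \<mapsto> x - y\<close>.\<close>

lemma hausdorff_measure_hyperplane:
  fixes u :: "'a::euclidean_space"
  assumes u: "norm u = 1" and A [measurable]: "A \<in> sets borel"
  defines "P \<equiv> \<lambda>x. x - (x \<bullet> u) *\<^sub>R u"
  shows "hausdorff_measure (DIM('a) - 1) ({x. x \<bullet> u = 0} \<inter> A) *
      emeasure lborel {x. norm (P x) \<le> 1 \<and> x \<bullet> u \<in> {0..1}} =
    hausdorff_measure (DIM('a) - 1) ({x. x \<bullet> u = 0} \<inter> cball 0 1) *
      emeasure lborel {x. P x \<in> A \<and> x \<bullet> u \<in> {0..1}}"
proof -
  define k where "k = DIM('a) - 1"
  define N where "N = {x. x \<bullet> u = 0}"
  define B where "B = {x. norm (P x) \<le> 1 \<and> x \<bullet> u \<in> {0..1}}"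
  \<comment> \<open>The Hausdorff measure carried by the hyperplane, kept as a measure on the whole
    space so that it can be paired with \<open>lborel\<close>.\<close>
  define \<mu> where "\<mu> = density (borel_hausdorff k) (indicator N)"
  have P [measurable]: "P \<in> borel_measurable borel" unfolding P_def by measurable
  have N [measurable]: "N \<in> sets borel" unfolding N_def by measurable
  have B [measurable]: "B \<in> sets borel" unfolding B_def by measurable
  have sets_\<mu> [measurable_cong]: "sets \<mu> = sets borel" by (simp add: \<mu>_def)
  have space_\<mu>: "space \<mu> = UNIV" by (simp add: \<mu>_def)
  have uu: "u \<bullet> u = 1" using u by (simp add: norm_eq_1)
  have PN: "P x \<in> N" for x by (simp add: P_def N_def inner_diff_left uu)
  have PP: "P x = x" if "x \<in> N" for x using that by (simp add: P_def N_def)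
  have P_diff: "P (x - y) = P x - P y" for x y
    by (simp add: P_def inner_diff_left algebra_simps)
  have N_add: "x + y \<in> N" "x - y \<in> N" if "x \<in> N" "y \<in> N" for x y
    using that by (auto simp: N_def inner_add_left inner_diff_left)
  have emeasure_\<mu>: "emeasure \<mu> S = hausdorff_measure k (N \<inter> S)" if "S \<in> sets borel" for S
  proof -
    have "emeasure \<mu> S = (\<integral>\<^sup>+x. indicator N x * indicator S x \<partial>borel_hausdorff k)"
      unfolding \<mu>_def using that by (subst emeasure_density) auto
    also have "\<dots> = (\<integral>\<^sup>+x. indicator (N \<inter> S) x \<partial>borel_hausdorff k)"
      by (simp add: indicator_inter_arith)
    finally show ?thesis using that by (simp add: emeasure_borel_hausdorff)
  qed
  have translate: "hausdorff_measure k {x \<in> N. x + v \<in> S} = hausdorff_measure k (N \<inter> S)"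
    if "v \<in> N" for v S
  proof -
    have "{x \<in> N. x + v \<in> S} = (+) (- v) ` (N \<inter> S)"
    proof safe
      fix x assume "x \<in> N" "x + v \<in> S"
      then show "x \<in> (+) (- v) ` (N \<inter> S)"
        using that N_add by (intro image_eqI[of _ _ "x + v"]) auto
    qed (use that N_add in auto)
    then show ?thesis by (simp only: hausdorff_measure_translation)
  qed
  interpret \<mu>: sigma_finite_measure \<mu>
  proof
    have "emeasure \<mu> (cball 0 (real r)) \<noteq> \<infinity>" for r
      using hausdorff_measure_hyperplane_finite[of u r] u
      by (cases "u = 0") (auto simp: emeasure_\<mu> N_def k_def inner_commute less_top)
    then show "\<exists>A. countable A \<and> A \<subseteq> sets \<mu> \<and> \<Union> A = space \<mu> \<and> (\<forall>a\<in>A. emeasure \<mu> a \<noteq> \<infinity>)"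
      by (intro exI[of _ "range (\<lambda>r. cball 0 (real r))"])
        (auto simp: sets_\<mu> space_\<mu> real_arch_simple)
  qed
  interpret pair_sigma_finite \<mu> "lborel :: 'a measure" ..
  \<comment> \<open>The substitution below needs \<open>P y = y\<close>, which holds only on the
    hyperplane; almost every \<open>y\<close> for \<open>\<mu>\<close> lies there.\<close>
  have AE_N: "AE y in \<mu>. y \<in> N"
    unfolding \<mu>_def by (subst AE_density) (auto simp: indicator_def)
  have "hausdorff_measure k (N \<inter> A) * emeasure lborel B =
      (\<integral>\<^sup>+x. hausdorff_measure k (N \<inter> A) * indicator B x \<partial>lborel)"
    by (simp add: nn_integral_cmult_indicator)
  also have "\<dots> = (\<integral>\<^sup>+x. (\<integral>\<^sup>+y. indicator A (y + P x) * indicator B x \<partial>\<mu>) \<partial>lborel)"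
  proof (rule nn_integral_cong)
    fix x
    have "(\<integral>\<^sup>+y. indicator A (y + P x) * indicator B x \<partial>\<mu>) =
        (\<integral>\<^sup>+y. indicator {y. y + P x \<in> A} y \<partial>\<mu>) * indicator B x"
      by (subst nn_integral_multc[symmetric]) (auto simp: indicator_def cong: if_cong)
    also have "(\<integral>\<^sup>+y. indicator {y. y + P x \<in> A} y \<partial>\<mu>) = emeasure \<mu> {y. y + P x \<in> A}"
      by (rule nn_integral_indicator) (simp add: sets_\<mu>)
    also have "\<dots> = hausdorff_measure k {y \<in> N. y + P x \<in> A}"
      by (subst emeasure_\<mu>) (auto simp: Int_def)
    finally show "hausdorff_measure k (N \<inter> A) * indicator B x =
        (\<integral>\<^sup>+y. indicator A (y + P x) * indicator B x \<partial>\<mu>)"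
      by (simp add: translate PN)
  qed
  also have "\<dots> = (\<integral>\<^sup>+y. (\<integral>\<^sup>+x. indicator A (y + P x) * indicator B x \<partial>lborel) \<partial>\<mu>)"
    by (rule Fubini') simp
  also have "\<dots> = (\<integral>\<^sup>+y. (\<integral>\<^sup>+x. indicator A (P x) * indicator B (x - y) \<partial>lborel) \<partial>\<mu>)"
  proof (rule nn_integral_cong_AE, rule AE_mp[OF AE_N], rule AE_I2, rule impI)
    fix y assume "y \<in> N"
    have "(\<integral>\<^sup>+x. indicator A (y + P x) * indicator B x \<partial>lborel) =
        (\<integral>\<^sup>+x. indicator A (y + P (x + - y)) * indicator B (x + - y) \<partial>lborel)"
      by (rule nn_integral_lborel_translation[symmetric]) simp
    then show "(\<integral>\<^sup>+x. indicator A (y + P x) * indicator B x \<partial>lborel) =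
        (\<integral>\<^sup>+x. indicator A (P x) * indicator B (x - y) \<partial>lborel)"
      using PP[OF \<open>y \<in> N\<close>] by (simp add: P_diff)
  qed
  also have "\<dots> = (\<integral>\<^sup>+x. (\<integral>\<^sup>+y. indicator A (P x) * indicator B (x - y) \<partial>\<mu>) \<partial>lborel)"
    by (rule Fubini'[symmetric]) simp
  also have "\<dots> = (\<integral>\<^sup>+x. hausdorff_measure k (N \<inter> cball 0 1) *
      indicator {x. P x \<in> A \<and> x \<bullet> u \<in> {0..1}} x \<partial>lborel)"
  proof (rule nn_integral_cong)
    fix x
    have "(\<integral>\<^sup>+y. indicator A (P x) * indicator B (x - y) \<partial>\<mu>) =
        indicator A (P x) * (\<integral>\<^sup>+y. indicator {y. x - y \<in> B} y \<partial>\<mu>)"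
      by (subst nn_integral_cmult[symmetric]) (auto simp: indicator_def cong: if_cong)
    also have "(\<integral>\<^sup>+y. indicator {y. x - y \<in> B} y \<partial>\<mu>) = emeasure \<mu> {y. x - y \<in> B}"
      by (rule nn_integral_indicator) (simp add: sets_\<mu>)
    also have "\<dots> = hausdorff_measure k {y \<in> N. x - y \<in> B}"
      by (subst emeasure_\<mu>) (auto simp: Int_def)
    \<comment> \<open>Subtracting \<open>y \<in> N\<close> leaves the height
      \<open>x \<bullet> u\<close> unchanged, so only the condition on \<open>P x - y\<close>
      depends on \<open>y\<close>: a unit ball around \<open>P x\<close> in the hyperplane.\<close>
    also have "{y \<in> N. x - y \<in> B} = (if x \<bullet> u \<in> {0..1} then {y \<in> N. y + - P x \<in> cball 0 1} else {})"
      by (auto simp: B_def N_def P_diff inner_diff_left norm_minus_commute) (auto simp: P_def)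
    also have "hausdorff_measure k \<dots> =
        hausdorff_measure k (N \<inter> cball 0 1) * indicator {0..1} (x \<bullet> u)"
      using translate[of "- P x" "cball 0 1"] PN[of x] by (auto simp: N_def)
    finally show "(\<integral>\<^sup>+y. indicator A (P x) * indicator B (x - y) \<partial>\<mu>) =
        hausdorff_measure k (N \<inter> cball 0 1) * indicator {x. P x \<in> A \<and> x \<bullet> u \<in> {0..1}} x"
      by (simp add: indicator_def)
  qed
  also have "\<dots> = hausdorff_measure k (N \<inter> cball 0 1) *
      emeasure lborel {x. P x \<in> A \<and> x \<bullet> u \<in> {0..1}}"
    by (rule nn_integral_cmult_indicator) simp
  finally show ?thesis by (simp add: k_def N_def B_def)
qed

lemma ennreal_mult_right_cancel_finite:
  fixes a b c :: ennreal
  shows "a * c = b * c \<Longrightarrow> c \<noteq> 0 \<Longrightarrow> c \<noteq> \<infinity> \<Longrightarrow> a = b"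
  using ennreal_mult_cancel_left[of c a b] by (simp add: mult.commute)

lemma hausdorff_measure_hyperplane_vimage:
  fixes u :: "'a::euclidean_space"
  assumes u: "norm u = 1" and A [measurable]: "A \<in> sets borel"
    and \<phi> [measurable]: "\<phi> \<in> borel_measurable borel"
    and \<phi>_hyperplane: "\<And>x. x \<bullet> u = 0 \<Longrightarrow> \<phi> x \<bullet> u = 0"
    and volume: "distr lborel borel (\<lambda>x. \<phi> (x - (x \<bullet> u) *\<^sub>R u) + (x \<bullet> u) *\<^sub>R u) = lborel"
  shows "hausdorff_measure (DIM('a) - 1) ({x. x \<bullet> u = 0} \<inter> \<phi> -` A) =
    hausdorff_measure (DIM('a) - 1) ({x. x \<bullet> u = 0} \<inter> A)"
proof -
  define P where "P x = x - (x \<bullet> u) *\<^sub>R u" for x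
  define F where "F x = \<phi> (P x) + (x \<bullet> u) *\<^sub>R u" for x
  have [measurable]: "P \<in> borel_measurable borel" unfolding P_def by measurable
  have F [measurable]: "F \<in> borel_measurable borel" unfolding F_def by measurable
  have uu: "u \<bullet> u = 1" using u by (simp add: norm_eq_1)
  have PN: "P x \<bullet> u = 0" for x by (simp add: P_def inner_diff_left uu)
  have Fu: "F x \<bullet> u = x \<bullet> u" for x
    using \<phi>_hyperplane[OF PN] by (simp add: F_def inner_add_left uu)
  then have PF: "P (F x) = \<phi> (P x)" for x
    unfolding P_def[of "F x"] by (simp add: F_def)
  let ?N = "{x. x \<bullet> u = 0}"
  let ?H = "hausdorff_measure (DIM('a) - 1) :: 'a set \<Rightarrow> ennreal"
  let ?B = "{x. norm (P x) \<le> 1 \<and> x \<bullet> u \<in> {0..1}}"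
  have "emeasure lborel {x. P x \<in> A \<and> x \<bullet> u \<in> {0..1}} =
      emeasure (distr lborel borel F) {x. P x \<in> A \<and> x \<bullet> u \<in> {0..1}}"
    using volume unfolding F_def P_def by simp
  also have "\<dots> = emeasure lborel {x. P x \<in> \<phi> -` A \<and> x \<bullet> u \<in> {0..1}}"
    by (subst emeasure_distr) (auto simp: PF Fu intro!: arg_cong[of _ _ "emeasure lborel"])
  finally have "?H (?N \<inter> \<phi> -` A) * emeasure lborel ?B = ?H (?N \<inter> A) * emeasure lborel ?B"
    using hausdorff_measure_hyperplane[OF u A]
      hausdorff_measure_hyperplane[OF u measurable_sets_borel[OF \<phi> A]]
    unfolding P_def by simp
  \<comment> \<open>The common factor is the volume of the cylinder over the unit ball. It cancels
    because it is positive, by a small ball around \<open>u / 2\<close>, and finite, by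
    boundedness.\<close>
  moreover have "emeasure lborel ?B \<noteq> 0"
  proof
    assume *: "emeasure lborel ?B = 0"
    have "ball ((1/2) *\<^sub>R u) (1/4) \<subseteq> ?B"
    proof
      fix x assume x: "x \<in> ball ((1/2) *\<^sub>R u) (1/4)"
      define v where "v = x - (1/2) *\<^sub>R u"
      have v: "norm v < 1/4" using x by (simp add: v_def dist_norm norm_minus_commute)
      have x': "x = v + (1/2) *\<^sub>R u" by (simp add: v_def)
      have vu: "\<bar>v \<bullet> u\<bar> < 1/4" using Cauchy_Schwarz_ineq2[of v u] u v by simp
      have "norm (v - (v \<bullet> u) *\<^sub>R u) \<le> norm v + \<bar>v \<bullet> u\<bar>"
        using norm_triangle_ineq4[of v "(v \<bullet> u) *\<^sub>R u"] u by simp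
      moreover have "P x = v - (v \<bullet> u) *\<^sub>R u"
        by (simp add: P_def x' inner_add_left uu algebra_simps)
      ultimately have "norm (P x) \<le> 1" using v vu by simp
      moreover have "x \<bullet> u \<in> {0..1}" using vu by (auto simp: x' inner_add_left uu)
      ultimately show "x \<in> ?B" by simp
    qed
    then have "emeasure lborel (ball ((1/2) *\<^sub>R u) (1/4)) \<le> emeasure lborel ?B"
      by (rule emeasure_mono) simp
    then show False
      using * content_ball_pos[of "1/4" "(1/2) *\<^sub>R u"]
      by (simp add: measure_def)
  qed
  moreover have "emeasure lborel ?B \<noteq> \<infinity>"
  proof -
    have "?B \<subseteq> cball 0 2"
    proof
      fix x assume x: "x \<in> ?B"
      have "norm x \<le> norm (P x) + norm ((x \<bullet> u) *\<^sub>R u)"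
        using norm_triangle_ineq[of "P x" "(x \<bullet> u) *\<^sub>R u"] by (simp add: P_def)
      then show "x \<in> cball 0 2" using x u by simp
    qed
    then have "bounded ?B" using bounded_cball bounded_subset by blast
    then show ?thesis using emeasure_bounded_finite[of ?B] by simp
  qed
  ultimately show ?thesis
    by (rule ennreal_mult_right_cancel_finite)
qed

section \<open>Volume preserving triangular maps\<close>

text \<open>Each point \<open>x\<close> is smeared along the line through \<open>x\<close> with direction \<open>e\<close>; on this line the
  map is a translation.\<close>

lemma emeasure_lborel_shear_vimage:
  fixes e :: "'a::euclidean_space"
  assumes e: "norm e = 1" and g [measurable]: "g \<in> borel_measurable borel"
    and inv: "\<And>x t. g (x + t *\<^sub>R e) = g x" and A [measurable]: "A \<in> sets borel"
  shows "emeasure lborel {x. x + g x *\<^sub>R e \<in> A} =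
    (\<integral>\<^sup>+x. (\<integral>\<^sup>+t. indicator A (x + t *\<^sub>R e) * indicator {0..1} (x \<bullet> e) \<partial>lborel) \<partial>lborel)"
proof -
  have ee: "e \<bullet> e = 1" using e by (simp add: norm_eq_1)
  have "emeasure lborel {x. x + g x *\<^sub>R e \<in> A} = (\<integral>\<^sup>+x. indicator A (x + g x *\<^sub>R e) \<partial>lborel)"
  proof -
    have "emeasure lborel {x. x + g x *\<^sub>R e \<in> A} =
        (\<integral>\<^sup>+x. indicator {x. x + g x *\<^sub>R e \<in> A} x \<partial>lborel)"
      by (rule nn_integral_indicator[symmetric]) simp
    then show ?thesis by (simp add: indicator_def)
  qed
  \<comment> \<open>The inserted factor is 1 exactly for \<open>t\<close> in an interval of length
    1, so its integral over \<open>t\<close> is 1.\<close>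
  also have "\<dots> = (\<integral>\<^sup>+x. (\<integral>\<^sup>+t. indicator A (x + g x *\<^sub>R e) *
      indicator {0..1} ((x - t *\<^sub>R e) \<bullet> e) \<partial>lborel) \<partial>lborel)"
  proof (rule nn_integral_cong)
    fix x :: 'a
    have "(\<integral>\<^sup>+t. indicator A (x + g x *\<^sub>R e) * indicator {0..1} ((x - t *\<^sub>R e) \<bullet> e) \<partial>lborel) =
        (\<integral>\<^sup>+t. indicator A (x + g x *\<^sub>R e) * indicator {x \<bullet> e - 1..x \<bullet> e} t \<partial>lborel)"
      by (intro nn_integral_cong) (auto simp: indicator_def inner_diff_left ee)
    also have "\<dots> = indicator A (x + g x *\<^sub>R e) * emeasure lborel {x \<bullet> e - 1..x \<bullet> e}"
      by (rule nn_integral_cmult_indicator) simp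
    finally show "indicator A (x + g x *\<^sub>R e) = (\<integral>\<^sup>+t. indicator A (x + g x *\<^sub>R e) *
        indicator {0..1} ((x - t *\<^sub>R e) \<bullet> e) \<partial>lborel)"
      by simp
  qed
  also have "\<dots> = (\<integral>\<^sup>+t. (\<integral>\<^sup>+x. indicator A (x + g x *\<^sub>R e) *
      indicator {0..1} ((x - t *\<^sub>R e) \<bullet> e) \<partial>lborel) \<partial>lborel)"
    by (rule lborel_pair.Fubini'[symmetric]) simp
  \<comment> \<open>Substitution of \<open>x + t *\<^sub>R e\<close> for \<open>x\<close>, under
    which \<open>g\<close> does not change. After another Fubini, \<open>g x\<close> is a mere shift
    of \<open>t\<close> and disappears.\<close>
  also have "\<dots> = (\<integral>\<^sup>+t. (\<integral>\<^sup>+x. indicator A (x + (t + g x) *\<^sub>R e) *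
      indicator {0..1} (x \<bullet> e) \<partial>lborel) \<partial>lborel)"
  proof (rule nn_integral_cong)
    fix t :: real
    have "(\<integral>\<^sup>+x. indicator A (x + g x *\<^sub>R e) * indicator {0..1} ((x - t *\<^sub>R e) \<bullet> e) \<partial>lborel) =
        (\<integral>\<^sup>+x. indicator A ((x + t *\<^sub>R e) + g (x + t *\<^sub>R e) *\<^sub>R e) *
          indicator {0..1} (((x + t *\<^sub>R e) - t *\<^sub>R e) \<bullet> e) \<partial>lborel)"
      by (rule nn_integral_lborel_translation[symmetric]) simp
    then show "(\<integral>\<^sup>+x. indicator A (x + g x *\<^sub>R e) * indicator {0..1} ((x - t *\<^sub>R e) \<bullet> e) \<partial>lborel) =
        (\<integral>\<^sup>+x. indicator A (x + (t + g x) *\<^sub>R e) * indicator {0..1} (x \<bullet> e) \<partial>lborel)"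
      by (simp add: inv scaleR_add_left add.assoc)
  qed
  also have "\<dots> = (\<integral>\<^sup>+x. (\<integral>\<^sup>+t. indicator A (x + (t + g x) *\<^sub>R e) *
      indicator {0..1} (x \<bullet> e) \<partial>lborel) \<partial>lborel)"
    by (rule lborel_pair.Fubini') simp
  also have "\<dots> = (\<integral>\<^sup>+x. (\<integral>\<^sup>+t. indicator A (x + t *\<^sub>R e) * indicator {0..1} (x \<bullet> e) \<partial>lborel) \<partial>lborel)"
    by (rule nn_integral_cong, rule nn_integral_lborel_translation) simp
  finally show ?thesis .
qed

text \<open>The formula for the volume of the preimage of \<open>A\<close> does not contain
  \<open>g\<close>, so it gives the same value for \<open>g = 0\<close>, that is, for the
  identity.\<close>

lemma lborel_distr_shear:
  fixes e :: "'a::euclidean_space"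
  assumes e: "norm e = 1" and g [measurable]: "g \<in> borel_measurable borel"
    and inv: "\<And>x t. g (x + t *\<^sub>R e) = g x"
  shows "distr lborel borel (\<lambda>x. x + g x *\<^sub>R e) = lborel"
proof (rule measure_eqI)
  fix A assume "A \<in> sets (distr lborel borel (\<lambda>x. x + g x *\<^sub>R e))"
  then have A [measurable]: "A \<in> sets borel" by simp
  have "emeasure (distr lborel borel (\<lambda>x. x + g x *\<^sub>R e)) A = emeasure lborel {x. x + g x *\<^sub>R e \<in> A}"
    by (subst emeasure_distr) (auto simp: vimage_def)
  also have "\<dots> = emeasure lborel {x. x + (\<lambda>_. 0) x *\<^sub>R e \<in> A}"
    unfolding emeasure_lborel_shear_vimage[OF e g inv A]
    by (rule emeasure_lborel_shear_vimage[symmetric]) (auto simp: e)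
  finally show "emeasure (distr lborel borel (\<lambda>x. x + g x *\<^sub>R e)) A = emeasure lborel A"
    by simp
qed simp

text \<open>The corrections are applied from the last vector to the first. When the one along
  \<open>e m\<close> is due, only corrections along later vectors have been made, and
  \<open>f m\<close> is blind to them; each stage is therefore a shear.\<close>

lemma lborel_distr_triangular:
  fixes e :: "nat \<Rightarrow> 'a::euclidean_space"
  assumes e: "\<And>i. i < n \<Longrightarrow> norm (e i) = 1"
    and f [measurable]: "\<And>i. f i \<in> borel_measurable borel"
    and inv: "\<And>i k x t. i \<le> k \<Longrightarrow> k < n \<Longrightarrow> f i (x + t *\<^sub>R e k) = f i x"
  shows "distr lborel borel (\<lambda>x. x + (\<Sum>i<n. f i x *\<^sub>R e i)) = lborel"
proof -
  define G where "G m x = x + (\<Sum>i=m..<n. f i x *\<^sub>R e i)" for m x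
  have G [measurable]: "G m \<in> borel_measurable borel" for m unfolding G_def by measurable
  have f_sum: "f i (x + (\<Sum>k\<in>K. c k *\<^sub>R e k)) = f i x" if "finite K" "K \<subseteq> {i..<n}" for i x c K
    using that
  proof (induction K)
    case (insert k K)
    have "f i (x + (\<Sum>k\<in>insert k K. c k *\<^sub>R e k)) = f i ((x + (\<Sum>k\<in>K. c k *\<^sub>R e k)) + c k *\<^sub>R e k)"
      using insert.hyps by (simp add: add_ac)
    also have "\<dots> = f i x" using insert.prems insert.IH inv[of i k] by simp
    finally show ?case .
  qed simp
  have "distr lborel borel (G m) = lborel" if "m \<le> n" for m
    using that
  proof (induction rule: inc_induct)
    case base
    then show ?case using distr_id2[of borel lborel] by (simp add: G_def id_def)
  next
    case (step m)
    let ?S = "\<lambda>x. x + f m x *\<^sub>R e m"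
    have "G m = (\<lambda>x. ?S (G (Suc m) x))"
    proof
      fix x
      have "f m (G (Suc m) x) = f m x" unfolding G_def by (rule f_sum) auto
      then show "G m x = ?S (G (Suc m) x)"
        using \<open>m < n\<close> by (simp add: G_def sum.atLeast_Suc_lessThan add_ac)
    qed
    then have "distr lborel borel (G m) = distr (distr lborel borel (G (Suc m))) borel ?S"
      by (subst distr_distr) (auto simp: comp_def)
    also have "\<dots> = lborel"
      unfolding step.IH using step.hyps by (intro lborel_distr_shear e inv) auto
    finally show ?case .
  qed
  from this[of 0] show ?thesis by (simp add: G_def[abs_def] atLeast0LessThan)
qed

section \<open>The group product modulo higher layers\<close>

definition bch_word :: "'a \<Rightarrow> 'a \<Rightarrow> (nat \<times> nat) list \<Rightarrow> 'a list" where
  "bch_word x y ps = concat (map (\<lambda>(r, s). replicate r x @ replicate s y) ps)"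

definition bch_coeff :: "(nat \<times> nat) list \<Rightarrow> real" where
  "bch_coeff ps = (- 1) ^ (length ps - 1) /
    (real (length ps) * real (\<Sum>(r, s)\<leftarrow>ps. r + s) * (\<Prod>(r, s)\<leftarrow>ps. fact r * fact s))"

definition bch_higher_indices :: "nat \<Rightarrow> (nat \<times> nat) list set" where
  "bch_higher_indices m = {ps \<in> bch_indices m. 2 \<le> (\<Sum>(r, s)\<leftarrow>ps. r + s)}"

lemma length_bch_word: "length (bch_word x y ps) = (\<Sum>(r, s)\<leftarrow>ps. r + s)"
proof (induction ps)
  case (Cons p ps)
  then show ?case unfolding bch_word_def by (cases p) auto
qed (simp add: bch_word_def)

lemma set_bch_word: "set (bch_word x y ps) \<subseteq> {x, y}"
proof (induction ps)
  case (Cons p ps)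
  obtain r s where p: "p = (r, s)" by (cases p)
  have word: "bch_word x y (p # ps) = replicate r x @ replicate s y @ bch_word x y ps"
    by (simp add: p bch_word_def)
  have "set (replicate r x) \<subseteq> {x, y}" "set (replicate s y) \<subseteq> {x, y}"
    by (simp_all add: set_replicate_conv_if)
  with Cons.IH show ?case unfolding word set_append by blast
qed (simp add: bch_word_def)

lemma replicate_all2: "P x y \<Longrightarrow> list_all2 P (replicate n x) (replicate n y)"
  by (simp add: list_all2_conv_all_nth)

lemma finite_bch_higher_indices: "finite (bch_higher_indices m)"
  by (simp add: bch_higher_indices_def finite_bch_indices)

text \<open>Every pair of an index has positive degree, so total degree 1 leaves only
  \<open>[(1, 0)]\<close> and \<open>[(0, 1)]\<close>, which give \<open>x\<close> and
  \<open>y\<close>. All other summands are brackets of at least two letters.\<close>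

lemma bch_split:
  assumes "1 \<le> m"
  shows "bch lie m x y = x + y +
    (\<Sum>ps\<in>bch_higher_indices m. bch_coeff ps *\<^sub>R nested_bracket lie (bch_word x y ps))"
proof -
  have "bch_indices m = {[(1, 0)], [(0, 1)]} \<union> bch_higher_indices m"
  proof (intro subset_antisym subsetI)
    fix ps assume ps: "ps \<in> bch_indices m"
    show "ps \<in> {[(1, 0)], [(0, 1)]} \<union> bch_higher_indices m"
    proof (cases "2 \<le> (\<Sum>(r, s)\<leftarrow>ps. r + s)")
      case True then show ?thesis using ps by (simp add: bch_higher_indices_def)
    next
      case False
      obtain r s qs where qs: "ps = (r, s) # qs"
        using ps by (cases ps) (auto simp: bch_indices_def)
      have rs: "0 < r + s" using ps qs by (simp add: bch_indices_def)
      have "qs = []"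
      proof (cases qs)
        case (Cons q qs')
        then have "0 < fst q + snd q"
          using ps qs by (auto simp: bch_indices_def case_prod_beta)
        then show ?thesis using False rs qs Cons by (cases q) auto
      qed simp
      moreover have "(r, s) = (1, 0) \<or> (r, s) = (0, 1)"
        using False rs qs by auto
      ultimately show ?thesis using qs by auto
    qed
  qed (use assms in \<open>auto simp: bch_indices_def bch_higher_indices_def\<close>)
  moreover have "{[(1, 0)], [(0, 1)]} \<inter> bch_higher_indices m = {}"
    by (auto simp: bch_higher_indices_def)
  ultimately have "bch lie m x y =
      (\<Sum>ps\<in>{[(1, 0)], [(0, 1)]}. bch_coeff ps *\<^sub>R nested_bracket lie (bch_word x y ps)) +
      (\<Sum>ps\<in>bch_higher_indices m. bch_coeff ps *\<^sub>R nested_bracket lie (bch_word x y ps))"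
    unfolding bch_def bch_coeff_def[symmetric] bch_word_def[symmetric]
    by (simp only: sum.union_disjoint[OF _ finite_bch_higher_indices] finite.intros)
  then show ?thesis by (simp add: bch_coeff_def bch_word_def)
qed

lemma continuous_on_nested_bracket:
  fixes lie :: "'a::euclidean_space \<Rightarrow> 'a \<Rightarrow> 'a"
  assumes "bilinear lie" "\<And>f. f \<in> set fs \<Longrightarrow> continuous_on S f"
  shows "continuous_on S (\<lambda>x. nested_bracket lie (map (\<lambda>f. f x) fs))"
  using assms(2)
proof (induction fs rule: induct_list012)
  case (3 f g fs)
  then show ?case
    using bounded_bilinear.continuous_on[of lie S f] assms(1)
    by (simp add: bilinear_conv_bounded_bilinear)
qed auto

lemma continuous_on_bch:
  fixes lie :: "'a::euclidean_space \<Rightarrow> 'a \<Rightarrow> 'a"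
  assumes "bilinear lie"
  shows "continuous_on S (bch lie m z)"
proof -
  have "continuous_on S (\<lambda>x. nested_bracket lie (bch_word z x ps))" for ps
  proof -
    \<comment> \<open>The same word is formed at function type, with a constant function and the
      identity as letters, and evaluated at \<open>x\<close>; this brings continuity of brackets of
      functions to bear.\<close>
    have "bch_word z x ps = map (\<lambda>f. f x) (bch_word (\<lambda>_. z) (\<lambda>x. x) ps)" for x
      by (induction ps) (auto simp: bch_word_def map_replicate_const)
    moreover have "continuous_on S (\<lambda>x. nested_bracket lie (map (\<lambda>f. f x) (bch_word (\<lambda>_. z) (\<lambda>x. x) ps)))"
      using assms set_bch_word[of "\<lambda>_. z" "\<lambda>x. x" ps]
      by (intro continuous_on_nested_bracket) (auto intro!: continuous_intros)
    ultimately show ?thesis by simp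
  qed
  then have "continuous_on S (\<lambda>x. bch lie m z x)"
    unfolding bch_def bch_word_def by (intro continuous_intros)
  then show ?thesis by simp
qed

section \<open>The descending filtration by layers and its brackets\<close>

context stratified_group
begin

text \<open>The terms of the lower central series of the stratified algebra. The union is not cut
  off at \<open>\<iota>\<close>: the later layers are zero, and sums of indices then need no
  bound.\<close>

definition tail_layers :: "nat \<Rightarrow> 'a set" where
  "tail_layers j = span (\<Union>i\<in>{j..}. V i)"

lemma subspace_tail_layers: "subspace (tail_layers j)"
  by (simp add: tail_layers_def)

lemma layer_subset_tail_layers: "j \<le> i \<Longrightarrow> V i \<subseteq> tail_layers j"
  unfolding tail_layers_def using span_superset by fastforce

lemma tail_layers_antimono: "j \<le> k \<Longrightarrow> tail_layers k \<subseteq> tail_layers j"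
  unfolding tail_layers_def by (intro span_mono UN_mono) auto

lemma layer_decomposition: "\<exists>f. (\<forall>j\<in>{1..\<iota>}. f j \<in> V j) \<and> (\<Sum>j=1..\<iota>. f j) = x"
  using direct_sum[of x] by (auto simp: PiE_iff)

lemma tail_layers_1: "tail_layers 1 = UNIV"
proof -
  have "x \<in> tail_layers 1" for x
  proof -
    obtain f where f: "\<And>j. j \<in> {1..\<iota>} \<Longrightarrow> f j \<in> V j" "(\<Sum>j=1..\<iota>. f j) = x"
      using layer_decomposition[of x] by blast
    have "(\<Sum>j=1..\<iota>. f j) \<in> tail_layers 1"
    proof (rule subspace_sum[OF subspace_tail_layers])
      fix j assume "j \<in> {1..\<iota>}"
      then show "f j \<in> tail_layers 1"
        using f(1) layer_subset_tail_layers[of 1 j] by auto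
    qed
    then show ?thesis by (simp only: f(2))
  qed
  then show ?thesis by auto
qed

lemma higher_layers_eq: "higher_layers V \<iota> = tail_layers 2"
proof
  show "higher_layers V \<iota> \<subseteq> tail_layers 2"
    unfolding higher_layers_def tail_layers_def by (intro span_mono) auto
  have "V i \<subseteq> higher_layers V \<iota>" if "2 \<le> i" for i
  proof (cases "i \<le> \<iota>")
    case True
    then show ?thesis unfolding higher_layers_def using that span_superset by fastforce
  next
    case False
    then show ?thesis using layer_beyond[of i] span_zero by (simp add: higher_layers_def)
  qed
  then show "tail_layers 2 \<subseteq> higher_layers V \<iota>"
    unfolding tail_layers_def by (intro span_minimal) (auto simp: higher_layers_def)
qed

lemma lie_anticommute: "lie x y = - lie y x"
proof -
  have "lie (x + y) (x + y) = lie x y + lie y x"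
    by (simp only: bilinear_ladd[OF bilinear_lie] bilinear_radd[OF bilinear_lie]) (simp add: lie_self)
  then have "lie x y + lie y x = 0" by (metis lie_self)
  then show ?thesis by (simp add: eq_neg_iff_add_eq_0)
qed

lemma linear_lie: "linear (lie x)" "linear (\<lambda>y. lie y x)"
  using bilinear_lie by (auto simp: bilinear_def)

lemma lie_span:
  assumes x: "x \<in> span A" and y: "y \<in> span B" and "subspace S"
    and AB: "\<And>a b. a \<in> A \<Longrightarrow> b \<in> B \<Longrightarrow> lie a b \<in> S"
  shows "lie x y \<in> S"
proof -
  have "lie a y \<in> S" if "a \<in> A" for a
  proof -
    have "B \<subseteq> {y. lie a y \<in> S}" using AB that by auto
    moreover have "subspace {y. lie a y \<in> S}"
      using linear_subspace_vimage[OF linear_lie(1) \<open>subspace S\<close>] by (simp add: vimage_def)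
    ultimately show ?thesis using span_minimal y by blast
  qed
  then have "A \<subseteq> {x. lie x y \<in> S}" by auto
  moreover have "subspace {x. lie x y \<in> S}"
    using linear_subspace_vimage[OF linear_lie(2) \<open>subspace S\<close>] by (simp add: vimage_def)
  ultimately show ?thesis using span_minimal x by blast
qed

lemma lie_layer_1:
  assumes "1 \<le> j" "x \<in> V 1" "y \<in> V j"
  shows "lie x y \<in> V (Suc j)"
  using assms unfolding stratified[OF \<open>1 \<le> j\<close>, symmetric] by (intro span_base) auto

text \<open>Stratification only controls brackets with the first layer. The layer
  \<open>V (Suc i)\<close> is spanned by brackets \<open>lie a b\<close> with
  \<open>a \<in> V 1\<close> and \<open>b \<in> V i\<close>, and Jacobi rewrites
  \<open>lie (lie a b) z\<close> as \<open>lie a (lie b z) - lie b (lie a z)\<close>. The second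
  term uses the induction hypothesis at \<open>Suc j\<close>, so \<open>j\<close> is kept
  arbitrary.\<close>

lemma lie_layers:
  assumes "1 \<le> i" "1 \<le> j" "x \<in> V i" "y \<in> V j"
  shows "lie x y \<in> V (i + j)"
  using assms
proof (induction i arbitrary: j x y rule: dec_induct)
  case base
  then show ?case using lie_layer_1 by simp
next
  case (step i)
  have "x \<in> span {lie a b |a b. a \<in> V 1 \<and> b \<in> V i}"
    using step.prems stratified[of i] step.hyps by simp
  moreover have "y \<in> span (V j)" using step.prems span_base by blast
  moreover have "subspace (V (Suc i + j))" by (rule subspace_layer) simp
  ultimately show ?case
  proof (rule lie_span)
    fix c z assume "c \<in> {lie a b |a b. a \<in> V 1 \<and> b \<in> V i}" and z: "z \<in> V j"
    then obtain a b where ab: "c = lie a b" "a \<in> V 1" "b \<in> V i" by blast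
    have "lie a (lie b z) \<in> V (Suc i + j)"
      using lie_layer_1[of "i + j" a "lie b z"] step.IH[of j b z] step.prems step.hyps ab z by simp
    moreover have "lie b (lie a z) \<in> V (Suc i + j)"
      using step.IH[of "Suc j" b "lie a z"] lie_layer_1[of j a z] step.prems ab z by simp
    moreover have "lie (lie a b) z = lie a (lie b z) - lie b (lie a z)"
    proof -
      have "lie b (lie z a) = - lie b (lie a z)"
        using lie_anticommute[of z a] bilinear_rneg[OF bilinear_lie] by simp
      then show ?thesis
        using jacobi[of a b z] lie_anticommute[of "lie a b" z]
        by (metis add.inverse_inverse diff_conv_add_uminus minus_unique neg_eq_iff_add_eq_0)
    qed
    ultimately show "lie c z \<in> V (Suc i + j)"
      using subspace_diff[OF subspace_layer[of "Suc i + j"]] ab by simp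
  qed
qed

lemma lie_tail_layers:
  assumes "1 \<le> i" "1 \<le> j" "x \<in> tail_layers i" "y \<in> tail_layers j"
  shows "lie x y \<in> tail_layers (i + j)"
  using assms(3,4) unfolding tail_layers_def[of i] tail_layers_def[of j]
proof (rule lie_span[OF _ _ subspace_tail_layers])
  fix a b assume "a \<in> (\<Union>i\<in>{i..}. V i)" "b \<in> (\<Union>i\<in>{j..}. V i)"
  then obtain i' j' where "i \<le> i'" "j \<le> j'" "a \<in> V i'" "b \<in> V j'" by auto
  then show "lie a b \<in> tail_layers (i + j)"
    using lie_layers[of i' j' a b] layer_subset_tail_layers[of "i + j" "i' + j'"] assms by auto
qed

text \<open>Telescoping: \<open>lie x n - lie x' n'\<close> is
  \<open>lie (x - x') n + lie x' (n - n')\<close>, and each bracket gains one step because every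
  element lies in \<open>tail_layers 1\<close>. The weaker first conclusion carries the induction,
  since a single letter gains nothing.\<close>

lemma nested_bracket_diff:
  assumes "list_all2 (\<lambda>a b. a - b \<in> tail_layers j) p q" "1 \<le> j"
  shows "nested_bracket lie p - nested_bracket lie q \<in> tail_layers j \<and>
    (2 \<le> length p \<longrightarrow> nested_bracket lie p - nested_bracket lie q \<in> tail_layers (Suc j))"
  using assms(1)
proof (induction p arbitrary: q rule: induct_list012)
  case 1
  then show ?case using subspace_0[OF subspace_tail_layers] by simp
next
  case (2 x)
  then show ?case by (auto simp: list_all2_Cons1)
next
  case (3 x y p)
  obtain x' y' q' where q: "q = x' # y' # q'" "x - x' \<in> tail_layers j"
      "list_all2 (\<lambda>a b. a - b \<in> tail_layers j) (y # p) (y' # q')"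
    using "3.prems" by (auto simp: list_all2_Cons1)
  define n n' where "n = nested_bracket lie (y # p)" and "n' = nested_bracket lie (y' # q')"
  have "n - n' \<in> tail_layers j" using "3.IH"(2)[OF q(3)] by (simp add: n_def n'_def)
  then have "lie x' (n - n') \<in> tail_layers (Suc j)"
    using lie_tail_layers[of 1 j x'] tail_layers_1 \<open>1 \<le> j\<close> by simp
  moreover have "lie (x - x') n \<in> tail_layers (Suc j)"
    using lie_tail_layers[of j 1 _ n] q(2) tail_layers_1 \<open>1 \<le> j\<close> by simp
  moreover have "lie x n - lie x' n' = lie (x - x') n + lie x' (n - n')"
    by (simp add: bilinear_lsub[OF bilinear_lie] bilinear_rsub[OF bilinear_lie])
  ultimately have "lie x n - lie x' n' \<in> tail_layers (Suc j)"
    using subspace_add[OF subspace_tail_layers] by simp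
  then show ?case
    using tail_layers_antimono[of j "Suc j"] by (auto simp: q(1) n_def n'_def)
qed

text \<open>This is the unit diagonal of left translation: the linear summand contributes exactly
  \<open>v\<close>, and all brackets change by something one step deeper.\<close>

lemma bch_add_diff:
  assumes "1 \<le> j" "v \<in> tail_layers j"
  shows "bch lie \<iota> z (x + v) - bch lie \<iota> z x - v \<in> tail_layers (Suc j)"
proof -
  have "nested_bracket lie (bch_word z (x + v) ps) - nested_bracket lie (bch_word z x ps)
      \<in> tail_layers (Suc j)" if "ps \<in> bch_higher_indices \<iota>" for ps
  proof -
    have "list_all2 (\<lambda>a b. a - b \<in> tail_layers j) (bch_word z (x + v) ps) (bch_word z x ps)"
      using assms(2) subspace_0[OF subspace_tail_layers]
      by (induction ps) (auto simp: bch_word_def intro!: list_all2_appendI replicate_all2)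
    moreover have "2 \<le> length (bch_word z (x + v) ps)"
      using that by (simp add: length_bch_word bch_higher_indices_def)
    ultimately show ?thesis using nested_bracket_diff assms(1) by blast
  qed
  then have "(\<Sum>ps\<in>bch_higher_indices \<iota>. bch_coeff ps *\<^sub>R
      (nested_bracket lie (bch_word z (x + v) ps) - nested_bracket lie (bch_word z x ps)))
      \<in> tail_layers (Suc j)"
    by (intro subspace_sum subspace_scale subspace_tail_layers)
  then show ?thesis
    by (simp add: bch_split[OF step_pos] sum_subtractf scaleR_diff_right algebra_simps)
qed

text \<open>On the first layer the group product is ordinary addition, so translation by
  \<open>z\<close> raises the height in a direction \<open>u \<in> V 1\<close> by
  \<open>z \<bullet> u\<close>.\<close>

lemma bch_diff_linear_part: "bch lie \<iota> z x - z - x \<in> tail_layers 2"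
proof -
  have "nested_bracket lie (bch_word z x ps) \<in> tail_layers 2" if "ps \<in> bch_higher_indices \<iota>" for ps
  proof -
    have "2 \<le> length (bch_word z x ps)"
      using that by (simp add: length_bch_word bch_higher_indices_def)
    then obtain a b w where "bch_word z x ps = a # b # w"
      by (metis Suc_le_length_iff numeral_2_eq_2)
    then show ?thesis
      using lie_tail_layers[of 1 1 a "nested_bracket lie (b # w)"] tail_layers_1
      by (simp add: numeral_2_eq_2)
  qed
  then have "(\<Sum>ps\<in>bch_higher_indices \<iota>. bch_coeff ps *\<^sub>R nested_bracket lie (bch_word z x ps))
      \<in> tail_layers 2"
    by (intro subspace_sum subspace_scale subspace_tail_layers)
  then show ?thesis by (simp add: bch_split[OF step_pos])
qed

text \<open>All letters are multiples of \<open>z\<close>, so every bracket of two or more of them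
  vanishes. Thus \<open>- z\<close> is the inverse of \<open>z\<close>, and translation by it moves
  a ball centred at \<open>z\<close> to the unit.\<close>

lemma bch_minus_self: "bch lie \<iota> (- z) z = 0"
proof -
  have span_z: "nested_bracket lie p \<in> span {z} \<and> (2 \<le> length p \<longrightarrow> nested_bracket lie p = 0)"
    if "set p \<subseteq> {- z, z}" for p
    using that
  proof (induction p rule: induct_list012)
    case (2 x)
    then show ?case by (auto simp: span_base span_neg)
  next
    case (3 x y p)
    then obtain a b where "x = a *\<^sub>R z" "nested_bracket lie (y # p) = b *\<^sub>R z"
    proof -
      have "x \<in> span {z}" "nested_bracket lie (y # p) \<in> span {z}"
        using 3 by (auto simp: span_base span_neg)
      then show thesis using that by (auto simp: span_singleton)
    qed
    then have "lie x (nested_bracket lie (y # p)) = 0"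
      by (simp add: bilinear_lmul[OF bilinear_lie] bilinear_rmul[OF bilinear_lie] lie_self)
    then show ?case by (simp add: span_zero)
  qed (simp add: span_zero)
  have "nested_bracket lie (bch_word (- z) z ps) = 0" if "ps \<in> bch_higher_indices \<iota>" for ps
    using span_z[OF set_bch_word] that by (simp add: length_bch_word bch_higher_indices_def)
  then show ?thesis by (simp add: bch_split[OF step_pos])
qed

end

section \<open>Adapted orthonormal bases\<close>

context stratified_group
begin

text \<open>Dimensions add because each layer meets the sum of the previous ones only in 0. Taken up
  to \<open>\<iota>\<close>, this shows that the blocks of an adapted basis exhaust all its
  indices.\<close>

lemma dim_layers_partial:
  assumes "m \<le> \<iota>"
  shows "dim {(\<Sum>j=1..m. f j) | f. \<forall>j\<in>{1..m}. f j \<in> V j} = (\<Sum>j=1..m. dim (V j)) \<and>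
    subspace {(\<Sum>j=1..m. f j) | f. \<forall>j\<in>{1..m}. f j \<in> V j}"
  using assms
proof (induction m)
  case 0
  then show ?case by simp
next
  case (Suc m)
  define U where "U = {(\<Sum>j=1..m. f j) | f. \<forall>j\<in>{1..m}. f j \<in> V j}"
  have U: "subspace U" "dim U = (\<Sum>j=1..m. dim (V j))" using Suc by (auto simp: U_def)
  have VS: "subspace (V (Suc m))" by (rule subspace_layer) simp
  have eq: "{(\<Sum>j=1..Suc m. f j) | f. \<forall>j\<in>{1..Suc m}. f j \<in> V j} = {x + y |x y. x \<in> U \<and> y \<in> V (Suc m)}"
  proof (intro subset_antisym subsetI)
    fix z assume "z \<in> {(\<Sum>j=1..Suc m. f j) | f. \<forall>j\<in>{1..Suc m}. f j \<in> V j}"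
    then obtain f where f: "\<forall>j\<in>{1..Suc m}. f j \<in> V j" "z = (\<Sum>j=1..Suc m. f j)" by blast
    then have "z = (\<Sum>j=1..m. f j) + f (Suc m)" "(\<Sum>j=1..m. f j) \<in> U" "f (Suc m) \<in> V (Suc m)"
      by (auto simp: U_def)
    then show "z \<in> {x + y |x y. x \<in> U \<and> y \<in> V (Suc m)}" by blast
  next
    fix z assume "z \<in> {x + y |x y. x \<in> U \<and> y \<in> V (Suc m)}"
    then obtain f y where f: "\<forall>j\<in>{1..m}. f j \<in> V j" "y \<in> V (Suc m)" "z = (\<Sum>j=1..m. f j) + y"
      by (auto simp: U_def)
    let ?g = "f(Suc m := y)"
    have "(\<Sum>j=1..m. ?g j) = (\<Sum>j=1..m. f j)" by (intro sum.cong) auto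
    then have "z = (\<Sum>j=1..Suc m. ?g j)" using f by simp
    moreover have "\<forall>j\<in>{1..Suc m}. ?g j \<in> V j" using f by auto
    ultimately show "z \<in> {(\<Sum>j=1..Suc m. f j) | f. \<forall>j\<in>{1..Suc m}. f j \<in> V j}" by blast
  qed
  have "x = 0" if x: "x \<in> U" "x \<in> V (Suc m)" for x
  proof -
    obtain f where f: "\<forall>j\<in>{1..m}. f j \<in> V j" "x = (\<Sum>j=1..m. f j)" using x(1) by (auto simp: U_def)
    \<comment> \<open>A common vector \<open>x\<close> yields a second decomposition of 0, with
      \<open>f\<close> on the first \<open>m\<close> layers and \<open>- x\<close> on the next. It
      is \<open>undefined\<close> outside the index range because uniqueness is stated for
      extensional families.\<close>
    define g where "g = (\<lambda>j. if j \<in> {1..m} then f j else if j = Suc m then - x else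
      if j \<in> {1..\<iota>} then 0 else undefined)"
    have 0: "0 \<in> V j" if "1 \<le> j" for j using subspace_0[OF subspace_layer[OF that]] .
    have "- x \<in> V (Suc m)" using subspace_neg[OF VS x(2)] .
    then have g: "g \<in> (\<Pi>\<^sub>E j\<in>{1..\<iota>}. V j)"
      using f(1) 0 Suc.prems by (auto simp: g_def PiE_iff extensional_def)
    have "(\<Sum>j=1..\<iota>. g j) = (\<Sum>j=1..Suc m. g j)"
      using Suc.prems by (intro sum.mono_neutral_right) (auto simp: g_def)
    also have "\<dots> = (\<Sum>j=1..m. g j) + g (Suc m)" by simp
    also have "(\<Sum>j=1..m. g j) = x" unfolding f(2) by (intro sum.cong) (auto simp: g_def)
    finally have "(\<Sum>j=1..\<iota>. g j) = 0" by (simp add: g_def)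
    moreover define h where "h = (\<lambda>j\<in>{1..\<iota>}. 0 :: 'a)"
    have "h \<in> (\<Pi>\<^sub>E j\<in>{1..\<iota>}. V j)" "(\<Sum>j=1..\<iota>. h j) = 0" using 0 by (auto simp: h_def)
    ultimately have "g = h" using direct_sum[of 0] g by blast
    then have "g (Suc m) = 0" using Suc.prems by (simp add: h_def)
    then show ?thesis by (simp add: g_def)
  qed
  then have int: "U \<inter> V (Suc m) = {0}" using subspace_0[OF U(1)] subspace_0[OF VS] by auto
  have "dim {x + y |x y. x \<in> U \<and> y \<in> V (Suc m)} = dim U + dim (V (Suc m))"
    using dim_sums_Int[OF U(1) VS] int by simp
  then show ?case using U VS by (simp only: eq) (simp add: subspace_sums)
qed

lemma sum_dim_layers: "(\<Sum>j=1..\<iota>. dim (V j)) = DIM('a)"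
proof -
  have "{(\<Sum>j=1..\<iota>. f j) | f. \<forall>j\<in>{1..\<iota>}. f j \<in> V j} = UNIV"
  proof (rule UNIV_eq_I[symmetric])
    fix x
    show "x \<in> {(\<Sum>j=1..\<iota>. f j) | f. \<forall>j\<in>{1..\<iota>}. f j \<in> V j}"
      using layer_decomposition[of x] by blast
  qed
  then show ?thesis using dim_layers_partial[OF order_refl] by simp
qed

end

locale adapted_stratified_group = stratified_group V \<iota> lie
  for V :: "nat \<Rightarrow> 'a::euclidean_space set" and \<iota> lie +
  fixes e :: "nat \<Rightarrow> 'a"
  assumes adapted: "adapted_orthonormal_basis V \<iota> e"
begin

definition block_start :: "nat \<Rightarrow> nat" where
  "block_start j = (\<Sum>i=1..<j. dim (V i))"

lemma block_start_mono: "i \<le> j \<Longrightarrow> block_start i \<le> block_start j"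
  unfolding block_start_def by (intro sum_mono2) auto

lemma block_start_last: "block_start (Suc \<iota>) = DIM('a)"
  using sum_dim_layers by (simp add: block_start_def atLeastLessThanSuc_atLeastAtMost)

lemma span_block: "j \<in> {1..\<iota>} \<Longrightarrow> span (e ` {block_start j..<block_start (Suc j)}) = V j"
  using adapted unfolding adapted_orthonormal_basis_def block_start_def
  by (simp add: atLeastLessThanSuc_atLeastAtMost)

lemma inner_e: "i < DIM('a) \<Longrightarrow> k < DIM('a) \<Longrightarrow> e i \<bullet> e k = (if i = k then 1 else 0)"
  using adapted unfolding adapted_orthonormal_basis_def by blast

lemma norm_e: "i < DIM('a) \<Longrightarrow> norm (e i) = 1"
  by (simp add: norm_eq_1 inner_e)

lemma layer_of_e:
  assumes "i < DIM('a)"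
  obtains j where "j \<in> {1..\<iota>}" "e i \<in> V j" "block_start j \<le> i"
proof -
  define j where "j = (LEAST j. i < block_start (Suc j))"
  have i: "i < block_start (Suc \<iota>)" using assms by (simp add: block_start_last)
  then have lt: "i < block_start (Suc j)" unfolding j_def by (rule LeastI)
  have "j \<le> \<iota>" unfolding j_def using i by (rule Least_le)
  have "j \<noteq> 0" using lt by (auto simp: block_start_def intro: gr0I)
  then have ge: "block_start j \<le> i"
    using not_less_Least[of "j - 1" "\<lambda>j. i < block_start (Suc j)"] by (simp add: j_def[symmetric])
  have j: "j \<in> {1..\<iota>}" using \<open>j \<noteq> 0\<close> \<open>j \<le> \<iota>\<close> by simp
  then have "e i \<in> V j" using span_block[OF j] lt ge span_base[of "e i"] by auto
  with j ge that show thesis by blast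
qed

lemma e_in_tail_layers:
  assumes "i < DIM('a)" "1 \<le> j" "block_start j \<le> i"
  shows "e i \<in> tail_layers j"
proof -
  obtain l where l: "l \<in> {1..\<iota>}" "e i \<in> V l" "block_start l \<le> i" using layer_of_e assms(1) .
  show ?thesis
  proof (cases "j \<le> l")
    case True then show ?thesis using layer_subset_tail_layers l by blast
  next
    case False
    \<comment> \<open>Were \<open>l\<close> smaller than \<open>j\<close>, the whole block of
      \<open>V l\<close> would come before \<open>i\<close>, making \<open>e i\<close> orthogonal to
      \<open>V l\<close> although it belongs to it.\<close>
    then have "block_start (Suc l) \<le> i" using block_start_mono[of "Suc l" j] assms(3) by simp
    have "x \<bullet> e i = 0" if "x \<in> V l" for x
    proof -
      have "orthogonal (e i) x"
      proof (rule orthogonal_to_span)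
        show "x \<in> span (e ` {block_start l..<block_start (Suc l)})" using that l span_block by simp
        fix y assume "y \<in> e ` {block_start l..<block_start (Suc l)}"
        then show "orthogonal (e i) y"
          using \<open>block_start (Suc l) \<le> i\<close> assms(1) inner_e by (auto simp: orthogonal_def)
      qed
      then show ?thesis by (simp add: orthogonal_def inner_commute)
    qed
    from this[OF l(2)] show ?thesis using inner_e[OF assms(1) assms(1)] by simp
  qed
qed

lemma layers_orthogonal:
  assumes "1 \<le> i" "i < j" "x \<in> V i" "y \<in> V j"
  shows "x \<bullet> y = 0"
proof (cases "j \<le> \<iota>")
  case False
  then show ?thesis using layer_beyond[of j] assms by simp
next
  case True
  have x: "x \<in> span (e ` {block_start i..<block_start (Suc i)})"
    and y: "y \<in> span (e ` {block_start j..<block_start (Suc j)})"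
    using assms True span_block by auto
  have le: "block_start (Suc i) \<le> block_start j" "block_start (Suc j) \<le> DIM('a)"
    using assms True block_start_mono[of "Suc i" j] block_start_mono[of "Suc j" "Suc \<iota>"]
    by (simp_all add: block_start_last)
  have "orthogonal a y" if "a \<in> e ` {block_start i..<block_start (Suc i)}" for a
  proof (rule orthogonal_to_span[OF y])
    fix b assume "b \<in> e ` {block_start j..<block_start (Suc j)}"
    then show "orthogonal a b" using that le inner_e by (auto simp: orthogonal_def)
  qed
  then have "orthogonal y x"
    using orthogonal_to_span[OF x, of y] by (simp add: orthogonal_commute)
  then show ?thesis by (simp add: orthogonal_def inner_commute)
qed

lemma tail_layers_orthogonal:
  assumes "1 \<le> j" "x \<in> V j" "y \<in> tail_layers (Suc j)"
  shows "x \<bullet> y = 0"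
proof -
  have "orthogonal x y"
  proof (rule orthogonal_to_span)
    show "y \<in> span (\<Union>i\<in>{Suc j..}. V i)" using assms(3) by (simp add: tail_layers_def)
    fix z assume "z \<in> (\<Union>i\<in>{Suc j..}. V i)"
    then obtain i where "Suc j \<le> i" "z \<in> V i" by auto
    then show "orthogonal x z"
      using layers_orthogonal[of j i x z] assms by (simp add: orthogonal_def)
  qed
  then show ?thesis by (simp add: orthogonal_def)
qed

lemma e_expansion: "(\<Sum>i<DIM('a). (x \<bullet> e i) *\<^sub>R e i) = x"
proof -
  have inj: "inj_on e {..<DIM('a)}"
    using inner_e by (intro inj_onI) (metis lessThan_iff zero_neq_one)
  have "span (e ` {..<DIM('a)}) = UNIV"
  proof -
    have "independent (e ` {..<DIM('a)})"
      using inner_e norm_e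
      by (intro pairwise_orthogonal_independent)
        (auto simp: pairwise_def orthogonal_def, metis norm_zero zero_neq_one)
    then show ?thesis
      using card_image[OF inj] card_ge_dim_independent[of "e ` {..<DIM('a)}" UNIV] by auto
  qed
  then have "(\<Sum>b\<in>e ` {..<DIM('a)}. (x \<bullet> b) *\<^sub>R b) = x"
    using inner_e norm_e by (intro orthonormal_basis_expand) (auto simp: pairwise_def orthogonal_def)
  then show ?thesis by (simp add: sum.reindex[OF inj])
qed

text \<open>The basis expansion is truncated after the block of \<open>V 1\<close>, whose vectors
  have the indices below \<open>block_start 2\<close>. Orthogonality of the first layer to the
  others makes the splitting unique.\<close>

lemma layer_1_projection:
  obtains p where "linear p" "\<And>x. p x \<in> V 1" "\<And>x. x - p x \<in> tail_layers 2"
    "\<And>x. x \<in> V 1 \<Longrightarrow> p x = x" "\<And>x. x \<in> tail_layers 2 \<Longrightarrow> p x = 0"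
proof -
  let ?n = "block_start 2"
  define p where "p x = (\<Sum>i<?n. (x \<bullet> e i) *\<^sub>R e i)" for x
  have le: "?n \<le> DIM('a)"
    using block_start_mono[of 2 "Suc \<iota>"] step_pos by (simp add: block_start_last)
  have V1: "e i \<in> V 1" if "i < ?n" for i
    using span_block[of 1] step_pos that span_base[of "e i" "e ` {block_start 1..<block_start 2}"]
    by (auto simp: numeral_2_eq_2 block_start_def)
  have lin: "linear p" unfolding p_def
    by (intro linear_compose_sum ballI) (simp add: linear_iff inner_add_left scaleR_add_left)
  have pV: "p x \<in> V 1" for x
    unfolding p_def using V1 subspace_layer[of 1] by (intro subspace_sum subspace_scale) auto
  have pW: "x - p x \<in> tail_layers 2" for x
  proof -
    have split: "{..<DIM('a)} = {..<?n} \<union> {?n..<DIM('a)}" using le by auto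
    have "(\<Sum>i<DIM('a). (x \<bullet> e i) *\<^sub>R e i) =
        p x + (\<Sum>i=?n..<DIM('a). (x \<bullet> e i) *\<^sub>R e i)"
      unfolding p_def split by (rule sum.union_disjoint) auto
    then have "x - p x = (\<Sum>i=?n..<DIM('a). (x \<bullet> e i) *\<^sub>R e i)"
      unfolding e_expansion by (metis add_diff_cancel_left')
    also have "\<dots> \<in> tail_layers 2"
      using e_in_tail_layers by (intro subspace_sum subspace_scale subspace_tail_layers) auto
    finally show ?thesis .
  qed
  have orth: "x = 0" if "x \<in> V 1" "x \<in> tail_layers 2" for x
    using tail_layers_orthogonal[of 1 x x] that by (simp add: numeral_2_eq_2)
  have "p x = x" if "x \<in> V 1" for x
    using orth[of "x - p x"] pW[of x] pV[of x] that subspace_diff[OF subspace_layer[of 1]] by simp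
  moreover have "p x = 0" if "x \<in> tail_layers 2" for x
    using orth[of "p x"] pW[of x] pV[of x] that subspace_diff[OF subspace_tail_layers[of 2], of x "x - p x"]
    by simp
  ultimately show thesis using that lin pV pW by blast
qed

lemma inner_V1_tail: "u \<in> V 1 \<Longrightarrow> w \<in> tail_layers 2 \<Longrightarrow> w \<bullet> u = 0"
  using tail_layers_orthogonal[of 1 u w] by (simp add: numeral_2_eq_2 inner_commute)

text \<open>The higher layers are orthogonal to \<open>V 1\<close>, so the only condition is on the
  component in \<open>V 1\<close>.\<close>

lemma vertical_hyperplane_eq:
  assumes "\<nu> \<in> V 1"
  shows "vertical_hyperplane V \<iota> \<nu> = {x. x \<bullet> \<nu> = 0}"
proof (intro subset_antisym subsetI)
  fix x assume "x \<in> vertical_hyperplane V \<iota> \<nu>"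
  then obtain h w where "x = h + w" "\<nu> \<bullet> h = 0" "w \<in> tail_layers 2"
    by (auto simp: vertical_hyperplane_def higher_layers_eq orthogonal_def)
  then show "x \<in> {x. x \<bullet> \<nu> = 0}"
    using inner_V1_tail[OF assms] by (simp add: inner_add_left inner_commute[of h])
next
  fix x assume x: "x \<in> {x. x \<bullet> \<nu> = 0}"
  obtain p where p: "p x \<in> V 1" "x - p x \<in> tail_layers 2" using layer_1_projection by metis
  have "orthogonal \<nu> (p x)"
    using inner_V1_tail[OF assms p(2)] x by (simp add: orthogonal_def inner_diff_left inner_diff_right inner_commute)
  then show "x \<in> vertical_hyperplane V \<iota> \<nu>"
    unfolding vertical_hyperplane_def higher_layers_eq using p by force
qed

section \<open>Slices of the unit ball\<close>

lemma hausdorff_measure_bch_slice: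
  assumes u: "u \<in> V 1" "norm u = 1" and B [measurable]: "B \<in> sets borel"
  shows "hausdorff_measure (DIM('a) - 1) ({x. x \<bullet> u = 0} \<inter> bch lie \<iota> z -` B) =
    hausdorff_measure (DIM('a) - 1) {x \<in> B. x \<bullet> u = z \<bullet> u}"
proof -
  define a where "a = (z \<bullet> u) *\<^sub>R u"
  \<comment> \<open>Translation by \<open>z\<close> sends the hyperplane through 0 to the parallel
    one at height \<open>z \<bullet> u\<close>; subtracting \<open>a\<close> brings it back to
    height 0.\<close>
  define \<phi> where "\<phi> x = bch lie \<iota> z x - a" for x
  have uu: "u \<bullet> u = 1" using u(2) by (simp add: norm_eq_1)
  have [measurable]: "bch lie \<iota> z \<in> borel_measurable borel"
    by (intro borel_measurable_continuous_onI continuous_on_bch bilinear_lie)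
  have \<phi> [measurable]: "\<phi> \<in> borel_measurable borel" unfolding \<phi>_def by measurable
  have \<phi>u: "\<phi> x \<bullet> u = 0" if "x \<bullet> u = 0" for x
    using inner_V1_tail[OF u(1) bch_diff_linear_part[of z x]] that
    by (simp add: \<phi>_def a_def inner_diff_left uu)
  define P where "P x = x - (x \<bullet> u) *\<^sub>R u" for x
  define F where "F x = \<phi> (P x) + (x \<bullet> u) *\<^sub>R u" for x
  have F [measurable]: "F \<in> borel_measurable borel" unfolding F_def P_def by measurable
  \<comment> \<open>\<open>F\<close> inherits the unit diagonal of the translation. \<open>P\<close>
    fixes \<open>tail_layers j\<close> pointwise for \<open>j \<ge> 2\<close>, nothing is to be
    shown for \<open>j = 1\<close>, and the component along \<open>u\<close> lost by
    \<open>P\<close> is restored by \<open>F\<close>.\<close>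
  have F_diff: "F (x + v) - F x - v \<in> tail_layers (Suc j)" if "1 \<le> j" "v \<in> tail_layers j" for x v j
  proof -
    have "P v \<in> tail_layers j"
    proof (cases "j = 1")
      case True then show ?thesis by (simp add: tail_layers_1[simplified])
    next
      case False
      then have "v \<in> tail_layers 2" using tail_layers_antimono[of 2 j] that by auto
      then show ?thesis using inner_V1_tail[OF u(1)] that by (simp add: P_def)
    qed
    moreover have "F (x + v) - F x - v = bch lie \<iota> z (P x + P v) - bch lie \<iota> z (P x) - P v"
      by (simp add: F_def \<phi>_def P_def inner_add_left algebra_simps)
    ultimately show ?thesis using bch_add_diff that by simp
  qed
  define f where "f i x = (F x - x) \<bullet> e i" for i x
  have "distr lborel borel (\<lambda>x. x + (\<Sum>i<DIM('a). f i x *\<^sub>R e i)) = lborel"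
  proof (rule lborel_distr_triangular[OF norm_e])
    fix i k :: nat and x t assume "i \<le> k" "k < DIM('a)"
    then obtain j where j: "j \<in> {1..\<iota>}" "e i \<in> V j" "block_start j \<le> i"
      using layer_of_e[of i] by auto
    \<comment> \<open>With \<open>e i\<close> in \<open>V j\<close> and \<open>i \<le> k\<close>,
      the vector \<open>e k\<close> lies in layer \<open>j\<close> or deeper. Moving along it
      changes \<open>F x - x\<close> only in layers after \<open>j\<close>, which are orthogonal to
      \<open>e i\<close>.\<close>
    have "t *\<^sub>R e k \<in> tail_layers j"
      using e_in_tail_layers[of k j] j \<open>i \<le> k\<close> \<open>k < DIM('a)\<close>
      by (intro subspace_scale subspace_tail_layers) auto
    then have "F (x + t *\<^sub>R e k) - F x - t *\<^sub>R e k \<in> tail_layers (Suc j)"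
      using F_diff j by simp
    then have "e i \<bullet> (F (x + t *\<^sub>R e k) - F x - t *\<^sub>R e k) = 0"
      using tail_layers_orthogonal[OF _ j(2)] j(1) by (metis atLeastAtMost_iff)
    then show "f i (x + t *\<^sub>R e k) = f i x"
      by (simp add: f_def inner_diff_left inner_diff_right inner_add_left inner_add_right inner_commute)
  qed (auto simp: f_def)
  then have "distr lborel borel F = lborel"
    by (simp add: f_def e_expansion)
  then have volume: "distr lborel borel (\<lambda>x. \<phi> (x - (x \<bullet> u) *\<^sub>R u) + (x \<bullet> u) *\<^sub>R u) = lborel"
    by (simp add: F_def[abs_def] P_def)
  have "{x. x \<bullet> u = 0} \<inter> bch lie \<iota> z -` B = {x. x \<bullet> u = 0} \<inter> \<phi> -` {y. y + a \<in> B}"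
    by (auto simp: \<phi>_def)
  also have "hausdorff_measure (DIM('a) - 1) \<dots> =
      hausdorff_measure (DIM('a) - 1) ({x. x \<bullet> u = 0} \<inter> {y. y + a \<in> B})"
    by (rule hausdorff_measure_hyperplane_vimage[OF u(2) _ \<phi> \<phi>u volume]) simp
  also have "{x. x \<bullet> u = 0} \<inter> {y. y + a \<in> B} = (+) (- a) ` {x \<in> B. x \<bullet> u = z \<bullet> u}"
  proof safe
    fix x assume "x \<bullet> u = 0" "x + a \<in> B"
    then show "x \<in> (+) (- a) ` {x \<in> B. x \<bullet> u = z \<bullet> u}"
      by (intro image_eqI[of _ _ "x + a"]) (auto simp: a_def inner_add_left uu)
  qed (auto simp: a_def inner_diff_left uu)
  also have "hausdorff_measure (DIM('a) - 1) \<dots> =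
      hausdorff_measure (DIM('a) - 1) {x \<in> B. x \<bullet> u = z \<bullet> u}"
    by (rule hausdorff_measure_translation)
  finally show ?thesis .
qed

lemma beta_eq_slices:
  assumes d: "homogeneous_distance V \<iota> lie d" and u: "u \<in> V 1" "norm u = 1" and c: "c \<noteq> 0"
  defines "B \<equiv> Metric_space.mcball UNIV d 0 1"
  shows "\<beta> V \<iota> d (c *\<^sub>R u) =
    (SUP z\<in>B. hausdorff_measure (DIM('a) - 1) {x \<in> B. x \<bullet> u = - (z \<bullet> u)})"
proof -
  interpret d: Metric_space UNIV d using d by (simp add: homogeneous_distance_def)
  have left_inv: "d (bch lie \<iota> z x) (bch lie \<iota> z y) = d x y" for x y z
    using d by (simp add: homogeneous_distance_def)
  \<comment> \<open>Left invariance under \<open>- z\<close> turns \<open>d z x\<close> into the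
    distance from 0 to the translate of \<open>x\<close>. The translating element is
    \<open>- z\<close>, which is the origin of the minus sign in the heights.\<close>
  have ball: "d.mcball z 1 = bch lie \<iota> (- z) -` B" for z
    unfolding B_def using left_inv[of "- z" z] by (auto simp: bch_minus_self)
  have "continuous_on UNIV (\<lambda>x. (\<lambda>(x, y). d x y) (0, x))"
    by (rule continuous_on_compose2[of UNIV]) 
      (use d in \<open>auto simp: homogeneous_distance_def intro!: continuous_intros\<close>)
  then have "continuous_on UNIV (d 0)" by simp
  then have "closed {x. d 0 x \<le> 1}" by (intro closed_Collect_le continuous_intros) auto
  then have B: "B \<in> sets borel" by (simp add: B_def d.mcball_def)
  have "c *\<^sub>R u \<in> V 1" using u subspace_scale[OF subspace_layer[of 1]] by simp
  then have N: "vertical_hyperplane V \<iota> (c *\<^sub>R u) = {x. x \<bullet> u = 0}"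
    using c by (simp add: vertical_hyperplane_eq)
  have "hausdorff_measure (DIM('a) - 1) (d.mcball z 1 \<inter> vertical_hyperplane V \<iota> (c *\<^sub>R u)) =
      hausdorff_measure (DIM('a) - 1) {x \<in> B. x \<bullet> u = - (z \<bullet> u)}" for z
    using hausdorff_measure_bch_slice[OF u B, of "- z"] by (simp add: N ball Int_commute)
  then show ?thesis by (simp only: \<beta>_def B_def[symmetric])
qed

text \<open>The extension acts as \<open>T\<^sub>0\<close> on the \<open>V 1\<close> component and
  as the identity on the rest. These components are orthogonal, so Pythagoras makes it an isometry
  of the whole space, hence bijective.\<close>

lemma vertical_extension_isometry:
  assumes T\<^sub>0: "T\<^sub>0 \<in> orthogonal_group (V 1)" "T\<^sub>0 \<in> F"
  obtains T where "T \<in> vertical_extensions V \<iota> F" "orthogonal_transformation T"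
    "\<And>x. x \<in> V 1 \<Longrightarrow> T x = T\<^sub>0 x"
proof -
  obtain p where p: "linear p" "\<And>x. p x \<in> V 1" "\<And>x. x - p x \<in> tail_layers 2"
    "\<And>x. x \<in> V 1 \<Longrightarrow> p x = x" "\<And>x. x \<in> tail_layers 2 \<Longrightarrow> p x = 0"
    using layer_1_projection by blast
  have T\<^sub>0': "T\<^sub>0 \<in> extensional (V 1)" "\<And>x. x \<in> V 1 \<Longrightarrow> T\<^sub>0 x \<in> V 1"
    "\<And>x y. x \<in> V 1 \<Longrightarrow> y \<in> V 1 \<Longrightarrow> T\<^sub>0 (x + y) = T\<^sub>0 x + T\<^sub>0 y"
    "\<And>c x. x \<in> V 1 \<Longrightarrow> T\<^sub>0 (c *\<^sub>R x) = c *\<^sub>R T\<^sub>0 x"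
    "\<And>x. x \<in> V 1 \<Longrightarrow> norm (T\<^sub>0 x) = norm x"
    using T\<^sub>0(1) unfolding orthogonal_group_def PiE_def by blast+
  define T where "T x = T\<^sub>0 (p x) + (x - p x)" for x
  have "linear T"
    using p(1,2) T\<^sub>0' by (intro linearI)
      (simp_all add: T_def linear_add linear_scale algebra_simps)
  moreover have "norm (T x) = norm x" for x
  proof -
    have "(norm (T x))\<^sup>2 = (norm (T\<^sub>0 (p x)))\<^sup>2 + (norm (x - p x))\<^sup>2"
      unfolding T_def using inner_V1_tail[OF T\<^sub>0'(2)[OF p(2)] p(3)]
      by (intro norm_add_Pythagorean) (simp add: orthogonal_def inner_commute)
    also have "\<dots> = (norm (p x))\<^sup>2 + (norm (x - p x))\<^sup>2" using T\<^sub>0'(5) p(2) by simp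
    also have "\<dots> = (norm (p x + (x - p x)))\<^sup>2"
      using inner_V1_tail[OF p(2) p(3)]
      by (intro norm_add_Pythagorean[symmetric]) (simp add: orthogonal_def inner_commute)
    finally show ?thesis by simp
  qed
  ultimately have orth: "orthogonal_transformation T" by (simp add: orthogonal_transformation)
  have TV: "T x = T\<^sub>0 x" if "x \<in> V 1" for x using that p(4) by (simp add: T_def)
  have "T\<^sub>0 0 = 0" using T\<^sub>0'(4)[of 0 0] subspace_0[OF subspace_layer[of 1]] by simp
  then have "T w = w" if "w \<in> tail_layers 2" for w using that p(5) by (simp add: T_def)
  \<comment> \<open>Membership in \<open>F\<close> demands equality of functions, not just agreement
    on \<open>V 1\<close>; it holds because \<open>T\<^sub>0\<close> is extensional.\<close>
  moreover have "restrict T (V 1) = T\<^sub>0"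
    using TV T\<^sub>0'(1) by (auto simp: restrict_def extensional_def fun_eq_iff)
  ultimately have "T \<in> vertical_extensions V \<iota> F"
    using \<open>linear T\<close> orthogonal_transformation_bij[OF orth] T\<^sub>0(2)
    by (simp add: vertical_extensions_def higher_layers_eq)
  then show thesis using that orth TV by blast
qed

text \<open>\<open>T\<close> preserves scalar products, so it maps the slice belonging to
  \<open>u\<close> and \<open>z\<close> isometrically onto the one belonging to \<open>u'\<close>
  and \<open>T z\<close>. As \<open>z\<close> runs through \<open>B\<close>, so does
  \<open>T z\<close>.\<close>

lemma SUP_slices_eq:
  fixes B :: "'a set"
  assumes T: "orthogonal_transformation T" "T ` B = B" "T u = u'"
  shows "(SUP z\<in>B. hausdorff_measure k {x \<in> B. x \<bullet> u = - (z \<bullet> u)}) =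
    (SUP z\<in>B. hausdorff_measure k {x \<in> B. x \<bullet> u' = - (z \<bullet> u')})"
proof -
  have inner: "T x \<bullet> u' = x \<bullet> u" for x
    using T(1,3) by (auto simp: orthogonal_transformation_def)
  have "hausdorff_measure k {x \<in> B. x \<bullet> u = - (z \<bullet> u)} =
      hausdorff_measure k {x \<in> B. x \<bullet> u' = - (T z \<bullet> u')}" for z
  proof -
    have "{x \<in> B. x \<bullet> u' = - (T z \<bullet> u')} = T ` {x \<in> B. x \<bullet> u = - (z \<bullet> u)}"
      using T(2) by (auto simp: inner[symmetric])
    then show ?thesis
      using hausdorff_measure_isometric_image[OF _ orthogonal_transformation_bij[OF T(1)], of k]
        T(1)[unfolded orthogonal_transformation_isometry] by simp
  qed
  then have "(SUP z\<in>B. hausdorff_measure k {x \<in> B. x \<bullet> u = - (z \<bullet> u)}) =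
      (SUP z\<in>T ` B. hausdorff_measure k {x \<in> B. x \<bullet> u' = - (z \<bullet> u')})"
    by (simp add: image_comp comp_def)
  then show ?thesis by (simp only: T(2))
qed

end

theorem theorem6p1:
  fixes V :: "nat \<Rightarrow> 'a::euclidean_space set" and \<iota> :: nat
    and lie :: "'a \<Rightarrow> 'a \<Rightarrow> 'a" and e :: "nat \<Rightarrow> 'a" and d :: "'a \<Rightarrow> 'a \<Rightarrow> real"
  assumes "stratified_group V \<iota> lie"
    and "adapted_orthonormal_basis V \<iota> e"
    and "homogeneous_distance V \<iota> lie d"
    and "vertically_symmetric V \<iota> d"
  shows "\<beta> V \<iota> d constant_on (V 1 - {0})"
proof -
  interpret adapted_stratified_group V \<iota> lie e
    using assms(1,2) by (simp add: adapted_stratified_group_def adapted_stratified_group_axioms_def)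
  let ?B = "Metric_space.mcball UNIV d 0 1"
  obtain F where F: "F \<subseteq> orthogonal_group (V 1)"
      "\<forall>\<nu>\<^sub>1\<in>V 1. \<forall>\<nu>\<^sub>2\<in>V 1. norm \<nu>\<^sub>1 = norm \<nu>\<^sub>2 \<longrightarrow> (\<exists>T\<in>F. T \<nu>\<^sub>1 = \<nu>\<^sub>2)"
      "\<forall>T\<in>vertical_extensions V \<iota> F. T ` ?B = ?B"
    using assms(4) unfolding vertically_symmetric_def by (elim exE conjE) (rule that)
  have "\<beta> V \<iota> d \<nu> = \<beta> V \<iota> d \<nu>'" if \<nu>: "\<nu> \<in> V 1 - {0}" "\<nu>' \<in> V 1 - {0}" for \<nu> \<nu>'
  proof -
    \<comment> \<open>Transitivity relates only vectors of equal norm, so both are normalized; this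
      does not change their vertical hyperplanes.\<close>
    define u u' where "u = \<nu> /\<^sub>R norm \<nu>" and "u' = \<nu>' /\<^sub>R norm \<nu>'"
    have u: "u \<in> V 1" "norm u = 1" "\<nu> = norm \<nu> *\<^sub>R u" "norm \<nu> \<noteq> 0"
      and u': "u' \<in> V 1" "norm u' = 1" "\<nu>' = norm \<nu>' *\<^sub>R u'" "norm \<nu>' \<noteq> 0"
      using \<nu> subspace_scale[OF subspace_layer[of 1]] by (auto simp: u_def u'_def)
    have "norm u = norm u'" by (simp add: u(2) u'(2))
    then obtain T\<^sub>0 where T\<^sub>0: "T\<^sub>0 \<in> F" "T\<^sub>0 u = u'" using F(2) u(1) u'(1) by blast
    then obtain T where T: "T \<in> vertical_extensions V \<iota> F" "orthogonal_transformation T" "T u = u'"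
      using vertical_extension_isometry[of T\<^sub>0 F] F(1) u(1) by (metis subsetD)
    show ?thesis
      using beta_eq_slices[OF assms(3) u(1,2,4)] beta_eq_slices[OF assms(3) u'(1,2,4)] u(3) u'(3)
        SUP_slices_eq[OF T(2) F(3)[rule_format, OF T(1)] T(3)] by simp
  qed
  then show ?thesis unfolding constant_on_def by blast
qed

end
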